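(* Let $R$ be a 2-fir and let $\Delta$ be an $F$-algebraic set of atoms of $R$. Then $rk(\Delta)=\infty$ if and only if one of the following holds: a) $\Delta$ contains infinitely many pairwise non-similar atoms; b) there exist an atom $p$ and infinitely many atoms $p_i\in\Delta\cap\Delta(p)$ such that, for left $R$-module isomorphisms $\phi_i:R/Rp_i\cong R/Rp$, the elements $\phi_i(1+Rp_i)$ generate an infinite dimensional right $C(p)$-subspace of $R/Rp$. If neither condition is satisfied, then $\Delta$ has finite rank and, letting $p_1,\dots,p_n$ be pairwise non-similar atoms representing the similarity classes that $\Delta$ intersects, $\Delta_i=\Delta\cap\Delta(p_i)$, choosing for each $\gamma\in\Delta_i$ a left $R$-module isomorphism $\phi_\gamma:R/R\gamma\cong R/Rp_i$, and letting $Y_i:=\sum_{\gamma\in\Delta_i}\phi_\gamma(1+R\gamma)C(p_i)$ (a right $C(p_i)$-subspace of $R/Rp_i$), one has $$\Delta=\bigcup_{i=1}^n\Delta_i,\qquad rk(\Delta)=\sum_{i=1}^n\dim_{C(p_i)}Y_i,\qquad \overline{\Delta}=\bigcup_{i=1}^n\overline{\Delta_i}.$$ In particular, if $f\in\mathcal F$ and $V(f)=\bigcup_{i=1}^r(V(f)\cap\Delta(p_i))$ is the decomposition of $V(f)$ into similarity classes (with $p_1,\dots,p_r$ pairwise non-similar atoms), then $$rk\,V(f)=\sum_{i=1}^r\dim_{C(p_i)}\ker(\lambda_{f,p_i}).$$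
   Context: Rings are associative with $1$, not necessarily commutative. A 2-fir is a domain $R$ such that for all $a,b\in R$ with $aR\cap bR\neq 0$ there are $c,d\in R$ with $aR\cap bR=cR$ and $aR+bR=dR$ (this condition is left-right symmetric). $U(R)$ is the group of units. An atom is a nonzero non-unit that is not a product of two non-units; $\mathcal A$ is the set of atoms. The length $\ell(a)$ of $a$ is the least $n$ such that $a$ is a product of $n$ atoms, $0$ if $a$ is a unit, and $\infty$ if $a$ is neither a unit nor a finite product of atoms; $\mathcal F=\{x\in R: \ell(x)<\infty\}$ (so $0\notin\mathcal F$, $U(R)\subseteq\mathcal F$). Nonzero elements $a,a'$ are similar if $R/Ra\cong R/Ra'$ as left $R$-modules; $\Delta(a)$ denotes the similarity class of $a$. The intersection of an empty family of left ideals is $R$. For an atom $p$, $C(p):=\mathrm{End}_R(R/Rp)$ is a division ring; endomorphisms are written on the right of their arguments, so that $R/Rp$ is a left $R$-, right $C(p)$-bimodule, in particular a right $C(p)$-vector space. For $f\in R$, $\lambda_{f,p}:R/Rp\to R/Rp$ is the right $C(p)$-linear map $x+Rp\mapsto fx+Rp$. A subset $\Delta\subseteq\mathcal F\setminus U(R)$ is $F$-algebraic if $\bigcap_{\delta\in\Delta}R\delta\neq0$. For $\Delta$ $F$-algebraic, $d\in\mathcal F$ is $F$-dependent on $\Delta$ if $\Delta\cup\{d\}$ is $F$-algebraic and there is a finite subset $\Gamma\subseteq\Delta$ with $Rd+\bigcap_{\gamma\in\Gamma}R\gamma\neq R$. $\Delta$ is $F$-independent if no $\delta\in\Delta$ is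 $F$-dependent on $\Delta\setminus\{\delta\}$. An $F$-basis of $\Delta$ is an $F$-independent subset $B\subseteq\Delta$ such that every element of $\Delta$ is $F$-dependent on $B$. For an $F$-algebraic set $\Delta$ of atoms, $rk(\Delta)=|B|$ for any $F$-basis $B$ of $\Delta$ (every such $\Delta$ has an $F$-basis, and all $F$-bases have the same cardinality); $rk(\Delta)=\infty$ means $B$ is infinite. The closure $\overline{\Delta}$ is the set of atoms that are $F$-dependent on $\Delta$. For $a\in R\setminus\{0\}$, $V(a)=\{q\in\mathcal A: a\in Rq\}$, an $F$-algebraic set. *)

theory Defs
  imports "HOL-Library.Set_Algebras" "HOL-Library.Extended_Nat" "HOL-Library.FuncSet"
begin

text \<open>
  The ring is a type of class \<open>ring_1_no_zero_divisors\<close> (a not necessarily commutative domain,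
  with \<open>1 \<noteq> 0\<close>). The library notions of divisibility and irreducibility are commutative,
  so units and atoms are defined here.
\<close>

definition lideal :: "'a::ring_1 \<Rightarrow> 'a set"  \<comment> \<open>\<open>Ra\<close>\<close>
  where "lideal a = range (\<lambda>r. r * a)"

text \<open>If \<open>aR \<inter> bR \<noteq> 0\<close>, then \<open>aR \<inter> bR = cR\<close> and \<open>aR + bR = dR\<close> for some \<open>c\<close> and \<open>d\<close>.\<close>

class two_fir = ring_1_no_zero_divisors +
  assumes two_fir:
    "range (\<lambda>r. a * r) \<inter> range (\<lambda>r. b * r) \<noteq> {0} \<Longrightarrow>
      \<exists>c d. range (\<lambda>r. a * r) \<inter> range (\<lambda>r. b * r) = range (\<lambda>r. c * r) \<and>
            {a * r + b * s |r s. True} = range (\<lambda>r. d * r)"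

definition ring_units :: "'a::ring_1 set"
  where "ring_units = {u. \<exists>v. u * v = 1 \<and> v * u = 1}"

definition atoms :: "'a::ring_1 set"
  where "atoms = {p. p \<noteq> 0 \<and> p \<notin> ring_units \<and>
    (\<forall>a b. p = a * b \<longrightarrow> a \<in> ring_units \<or> b \<in> ring_units)}"

definition product_of_atoms :: "nat \<Rightarrow> 'a::ring_1 \<Rightarrow> bool"
  where "product_of_atoms n a \<longleftrightarrow> (\<exists>ps. length ps = n \<and> set ps \<subseteq> atoms \<and> a = prod_list ps)"

definition atomic_length :: "'a::ring_1 \<Rightarrow> enat"
  where "atomic_length a =
    (if a \<in> ring_units then 0
     else if \<exists>n. product_of_atoms n a then enat (LEAST n. product_of_atoms n a)
     else \<infinity>)"

definition finite_length :: "'a::ring_1 set"  \<comment> \<open>the set \<open>\<F>\<close>\<close>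
  where "finite_length = {x. atomic_length x < \<infinity>}"


subsection \<open>The left modules \<open>R/Ra\<close> and their homomorphisms\<close>

text \<open>
  Elements of \<open>R/Ra\<close> are the cosets \<open>x + Ra\<close>, as sets. The sum of two cosets is their setwise
  sum, the zero element is \<open>lideal a\<close>, and \<open>r \<cdot> (x + Ra) = rx + Ra\<close> is
  \<open>r *o (x + Ra) + Ra\<close>: the set \<open>r *o (x + Ra) = rx + rRa\<close> alone may be smaller than a coset.
\<close>

definition qcoset :: "'a::ring_1 \<Rightarrow> 'a \<Rightarrow> 'a set"  \<comment> \<open>\<open>x + Ra\<close>\<close>
  where "qcoset a x = x +o lideal a"

definition qmod :: "'a::ring_1 \<Rightarrow> 'a set set"
  where "qmod a = range (qcoset a)"

definition qscale :: "'a::ring_1 \<Rightarrow> 'a \<Rightarrow> 'a set \<Rightarrow> 'a set"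
  where "qscale a r A = (r *o A) + lideal a"

lemma qcoset_add: "qcoset a x + qcoset a y = qcoset a (x + y)"
proof (intro equalityI subsetI)
  fix z assume "z \<in> qcoset a x + qcoset a y"
  then obtain r s where "z = (x + r * a) + (y + s * a)"
    by (auto simp: qcoset_def lideal_def elt_set_plus_def set_plus_def)
  then have "z = (x + y) + (r + s) * a" by (simp add: algebra_simps)
  then show "z \<in> qcoset a (x + y)" by (auto simp: qcoset_def lideal_def elt_set_plus_def)
next
  fix z assume "z \<in> qcoset a (x + y)"
  then obtain r where "z = (x + y) + r * a"
    by (auto simp: qcoset_def lideal_def elt_set_plus_def)
  then have z: "z = (x + r * a) + (y + 0 * a)" by (simp add: algebra_simps)
  have "x + r * a \<in> qcoset a x" "y + 0 * a \<in> qcoset a y"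
    unfolding qcoset_def lideal_def elt_set_plus_def by blast+
  then show "z \<in> qcoset a x + qcoset a y" unfolding z by (rule set_plus_intro)
qed

lemma qscale_qcoset: "qscale a r (qcoset a x) = qcoset a (r * x)"
proof (intro equalityI subsetI)
  fix z assume "z \<in> qscale a r (qcoset a x)"
  then obtain s t where "z = r * (x + s * a) + t * a"
    by (auto simp: qscale_def qcoset_def lideal_def elt_set_plus_def elt_set_times_def set_plus_def)
  then have "z = r * x + (r * s + t) * a" by (simp add: algebra_simps)
  then show "z \<in> qcoset a (r * x)" by (auto simp: qcoset_def lideal_def elt_set_plus_def)
next
  fix z assume "z \<in> qcoset a (r * x)"
  then obtain t where "z = r * x + t * a"
    by (auto simp: qcoset_def lideal_def elt_set_plus_def)
  then have z: "z = r * (x + 0 * a) + t * a" by simp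
  have "x + 0 * a \<in> qcoset a x"
    unfolding qcoset_def lideal_def elt_set_plus_def by blast
  then have "r * (x + 0 * a) \<in> r *o qcoset a x" by (rule set_times_intro2)
  moreover have "t * a \<in> lideal a" by (simp add: lideal_def)
  ultimately show "z \<in> qscale a r (qcoset a x)" unfolding z qscale_def by (rule set_plus_intro)
qed

definition qhom :: "'a::ring_1 \<Rightarrow> 'a \<Rightarrow> ('a set \<Rightarrow> 'a set) set"  \<comment> \<open>\<open>R/Ra \<rightarrow> R/Rb\<close>\<close>
  where "qhom a b = {\<phi>. \<phi> \<in> qmod a \<rightarrow> qmod b \<and>
    (\<forall>A\<in>qmod a. \<forall>B\<in>qmod a. \<phi> (A + B) = \<phi> A + \<phi> B) \<and>
    (\<forall>r. \<forall>A\<in>qmod a. \<phi> (qscale a r A) = qscale b r (\<phi> A))}"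

definition qiso :: "'a::ring_1 \<Rightarrow> 'a \<Rightarrow> ('a set \<Rightarrow> 'a set) set"
  where "qiso a b = {\<phi> \<in> qhom a b. bij_betw \<phi> (qmod a) (qmod b)}"

definition similar_elts :: "'a::ring_1 \<Rightarrow> 'a \<Rightarrow> bool"
  where "similar_elts a b \<longleftrightarrow> a \<noteq> 0 \<and> b \<noteq> 0 \<and> qiso a b \<noteq> {}"

definition sim_class :: "'a::ring_1 \<Rightarrow> 'a set"  \<comment> \<open>\<open>\<Delta>(a)\<close>\<close>
  where "sim_class a = {b. similar_elts a b}"


subsection \<open>\<open>R/Rp\<close> as a right vector space over \<open>C(p)\<close>\<close>

text \<open>
  \<open>C(p)\<close> consists of the endomorphisms of \<open>R/Rp\<close> (as functions extensional on \<open>R/Rp\<close>), and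
  the right action of \<open>c \<in> C(p)\<close> on \<open>A \<in> R/Rp\<close> is function application \<open>c A\<close>. The multiplication
  of \<open>C(p)\<close> (composition in the order dictated by the right action) is not needed to
  speak about subspaces, spans and dimensions.

  The definitions of independence and dimension are only meant for \<open>p\<close> an atom, where
  \<open>C(p)\<close> is a division ring.
\<close>

definition qEnd :: "'a::ring_1 \<Rightarrow> ('a set \<Rightarrow> 'a set) set"  \<comment> \<open>\<open>C(p)\<close>\<close>
  where "qEnd p = qhom p p \<inter> extensional (qmod p)"

definition C_subspace :: "'a::ring_1 \<Rightarrow> 'a set set \<Rightarrow> bool"
  where "C_subspace p W \<longleftrightarrow> W \<subseteq> qmod p \<and> lideal p \<in> W \<and>
    (\<forall>A\<in>W. \<forall>B\<in>W. A + B \<in> W) \<and> (\<forall>c\<in>qEnd p. \<forall>A\<in>W. c A \<in> W)"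

definition C_span :: "'a::ring_1 \<Rightarrow> 'a set set \<Rightarrow> 'a set set"
  where "C_span p S = C_subspace p hull S"

definition C_independent :: "'a::ring_1 \<Rightarrow> 'a set set \<Rightarrow> bool"
  where "C_independent p B \<longleftrightarrow> (\<forall>v\<in>B. v \<notin> C_span p (B - {v}))"

definition C_basis :: "'a::ring_1 \<Rightarrow> 'a set set \<Rightarrow> 'a set set \<Rightarrow> bool"
  where "C_basis p W B \<longleftrightarrow> B \<subseteq> W \<and> C_independent p B \<and> C_span p B = W"

definition ecard :: "'b set \<Rightarrow> enat"
  where "ecard A = (if finite A then enat (card A) else \<infinity>)"

definition C_dim :: "'a::ring_1 \<Rightarrow> 'a set set \<Rightarrow> enat"
  where "C_dim p W = ecard (SOME B. C_basis p W B)"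

definition lmult :: "'a::ring_1 \<Rightarrow> 'a \<Rightarrow> 'a set \<Rightarrow> 'a set"  \<comment> \<open>\<open>\<lambda>\<^bsub>f,p\<^esub>\<close>\<close>
  where "lmult f p = restrict (qscale p f) (qmod p)"

definition lmult_ker :: "'a::ring_1 \<Rightarrow> 'a \<Rightarrow> 'a set set"
  where "lmult_ker f p = {A \<in> qmod p. lmult f p A = lideal p}"


subsection \<open>\<open>F\<close>-algebraic sets, \<open>F\<close>-dependence and rank\<close>

text \<open>In HOL the intersection of an empty family is \<open>UNIV\<close>, as required.\<close>

definition F_algebraic :: "'a::ring_1 set \<Rightarrow> bool"
  where "F_algebraic \<Delta> \<longleftrightarrow> \<Delta> \<subseteq> finite_length - ring_units \<and> (\<Inter>\<delta>\<in>\<Delta>. lideal \<delta>) \<noteq> {0}"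

definition F_dependent :: "'a::ring_1 \<Rightarrow> 'a set \<Rightarrow> bool"
  where "F_dependent d \<Delta> \<longleftrightarrow> d \<in> finite_length \<and> F_algebraic (insert d \<Delta>) \<and>
    (\<exists>\<Gamma>\<subseteq>\<Delta>. finite \<Gamma> \<and> lideal d + (\<Inter>\<gamma>\<in>\<Gamma>. lideal \<gamma>) \<noteq> UNIV)"

definition F_independent :: "'a::ring_1 set \<Rightarrow> bool"
  where "F_independent \<Delta> \<longleftrightarrow> F_algebraic \<Delta> \<and> (\<forall>\<delta>\<in>\<Delta>. \<not> F_dependent \<delta> (\<Delta> - {\<delta>}))"

definition F_basis :: "'a::ring_1 set \<Rightarrow> 'a set \<Rightarrow> bool"
  where "F_basis \<Delta> B \<longleftrightarrow> B \<subseteq> \<Delta> \<and> F_independent B \<and> (\<forall>d\<in>\<Delta>. F_dependent d B)"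

definition F_rank :: "'a::ring_1 set \<Rightarrow> enat"
  where "F_rank \<Delta> = ecard (SOME B. F_basis \<Delta> B)"

definition F_closure :: "'a::ring_1 set \<Rightarrow> 'a set"
  where "F_closure \<Delta> = {p \<in> atoms. F_dependent p \<Delta>}"

definition V_set :: "'a::ring_1 \<Rightarrow> 'a set"  \<comment> \<open>\<open>V(a)\<close>\<close>
  where "V_set a = {q \<in> atoms. a \<in> lideal q}"


subsection \<open>Similarity classes met by a set of atoms\<close>

definition nonsimilar_atoms :: "nat \<Rightarrow> (nat \<Rightarrow> 'a::ring_1) \<Rightarrow> bool"
  where "nonsimilar_atoms n p \<longleftrightarrow> (\<forall>i<n. p i \<in> atoms) \<and>
    (\<forall>i<n. \<forall>j<n. i \<noteq> j \<longrightarrow> \<not> similar_elts (p i) (p j))"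

text \<open>\<open>p 0, \<dots>, p (n - 1)\<close> represent, without repetition, exactly the classes that \<open>\<Delta>\<close> intersects.\<close>

definition class_reps :: "'a::ring_1 set \<Rightarrow> nat \<Rightarrow> (nat \<Rightarrow> 'a) \<Rightarrow> bool"
  where "class_reps \<Delta> n p \<longleftrightarrow> nonsimilar_atoms n p \<and>
    (\<forall>i<n. \<Delta> \<inter> sim_class (p i) \<noteq> {}) \<and> (\<forall>\<gamma>\<in>\<Delta>. \<exists>i<n. \<gamma> \<in> sim_class (p i))"

text \<open>
  A choice of isomorphisms \<open>\<phi> p \<gamma> : R/R\<gamma> \<cong> R/Rp\<close>, for every atom \<open>p\<close> and every \<open>\<gamma> \<in> \<Delta>\<close> similar
  to \<open>p\<close>; one exists by the definition of similarity.
\<close>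

definition iso_choice :: "'a::ring_1 set \<Rightarrow> ('a \<Rightarrow> 'a \<Rightarrow> 'a set \<Rightarrow> 'a set) \<Rightarrow> bool"
  where "iso_choice \<Delta> \<phi> \<longleftrightarrow> (\<forall>p\<in>atoms. \<forall>\<gamma>\<in>\<Delta> \<inter> sim_class p. \<phi> p \<gamma> \<in> qiso \<gamma> p)"

text \<open>The right subspace \<open>\<Sum>\<gamma>\<in>S. \<phi> p \<gamma> (1 + R\<gamma>) C(p)\<close> of \<open>R/Rp\<close>.\<close>

definition gen_subspace :: "('a::ring_1 \<Rightarrow> 'a \<Rightarrow> 'a set \<Rightarrow> 'a set) \<Rightarrow> 'a \<Rightarrow> 'a set \<Rightarrow> 'a set set"
  where "gen_subspace \<phi> p S = C_span p ((\<lambda>\<gamma>. \<phi> p \<gamma> (qcoset \<gamma> 1)) ` S)"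

definition infinitely_many_classes :: "'a::ring_1 set \<Rightarrow> bool"
  where "infinitely_many_classes \<Delta> \<longleftrightarrow>
    (\<exists>S\<subseteq>\<Delta>. infinite S \<and> pairwise (\<lambda>p q. \<not> similar_elts p q) S)"

definition infinite_dim_class ::
    "'a::ring_1 set \<Rightarrow> ('a \<Rightarrow> 'a \<Rightarrow> 'a set \<Rightarrow> 'a set) \<Rightarrow> bool"
  where "infinite_dim_class \<Delta> \<phi> \<longleftrightarrow>
    (\<exists>p\<in>atoms. \<exists>S\<subseteq>\<Delta> \<inter> sim_class p. infinite S \<and> C_dim p (gen_subspace \<phi> p S) = \<infinity>)"

end

theory Submission
  imports Defs
begin

text \<open>
  The left ideals \<open>R\<gamma>\<close> behave like hyperplanes: if \<open>Rm \<inter> R\<gamma> \<subseteq> R\<delta>\<close> with \<open>m \<notin> R\<delta>\<close>, then the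
  annihilators of \<open>m\<close> in \<open>R/R\<gamma>\<close> and \<open>R/R\<delta>\<close> are generated by the same atom, so \<open>\<gamma>\<close> and \<open>\<delta>\<close> are
  similar and \<open>Rm \<inter> R\<delta> \<subseteq> R\<gamma>\<close>. Hence \<open>F\<close>-dependence has the exchange property and splits over
  similarity classes. Inside the class of \<open>p\<close>, an atom \<open>\<gamma>\<close> is the annihilator of the vector
  \<open>\<phi>\<^sub>\<gamma>(1 + R\<gamma>)\<close> of \<open>R/Rp\<close>, and a density argument identifies \<open>F\<close>-dependence with
  \<open>C(p)\<close>-linear dependence of these vectors. Peeling off atoms one at a time, \<open>V(f)\<close> meets only
  finitely many classes, and \<open>ker \<lambda>\<^bsub>f,p\<^esub>\<close> is spanned by the vectors of \<open>V(f) \<inter> \<Delta>(p)\<close>.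
\<close>

section \<open>Finitary closure operators with the exchange property\<close>

text \<open>The remedy is a nonzero common left multiple \<open>f\<close>. Principal left ideals
  that share a nonzero element have a principal sum and a principal intersection, and a nonzero
  coset killed by some nonzero ring element generates \<open>R/Rp\<close>. An F-algebraic set of
  atoms comes with such an \<open>f\<close>, which is therefore carried along in most of the lemmas.
  A scalar of \<open>C(p)\<close> is handled as right multiplication by some \<open>g\<close> with
  \<open>p * g\<close> in \<open>Rp\<close>; for it \<open>p\<close> itself is the killing element,
  whence nonzero scalars are invertible. The vector of \<open>\<gamma>\<close> is the image of
  \<open>1 + R\<gamma>\<close> because its annihilator is exactly \<open>R\<gamma>\<close>:
  inclusions between intersections of left ideals turn into statements on annihilators of vectors.
  \<open>F_rank\<close> and \<open>C_dim\<close> both measure a basis picked by \<open>SOME\<close>.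
  Independence of that choice is the same exchange argument for both, hence the abstract closure
  operator, whose axioms are guarded by a ground set \<open>E\<close> because F-dependence satisfies
  them only inside one F-algebraic set.\<close>

locale pregeometry =
  fixes E :: "'b set" and cl :: "'b set \<Rightarrow> 'b set"
  assumes cl_subset: "S \<subseteq> E \<Longrightarrow> cl S \<subseteq> E"
    and subset_cl: "S \<subseteq> E \<Longrightarrow> S \<subseteq> cl S"
    and cl_mono: "S \<subseteq> T \<Longrightarrow> T \<subseteq> E \<Longrightarrow> cl S \<subseteq> cl T"
    and cl_idem: "S \<subseteq> E \<Longrightarrow> cl (cl S) \<subseteq> cl S"
    and finitary: "S \<subseteq> E \<Longrightarrow> x \<in> cl S \<Longrightarrow> \<exists>T\<subseteq>S. finite T \<and> x \<in> cl T"
    and exchange: "S \<subseteq> E \<Longrightarrow> x \<in> E \<Longrightarrow> y \<in> E \<Longrightarrow> x \<in> cl (insert y S) \<Longrightarrow> x \<notin> cl S \<Longrightarrow>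
      y \<in> cl (insert x S)"
begin

definition indep :: "'b set \<Rightarrow> bool"
  where "indep I \<longleftrightarrow> I \<subseteq> E \<and> (\<forall>x\<in>I. x \<notin> cl (I - {x}))"

lemma cl_least: "S \<subseteq> cl T \<Longrightarrow> T \<subseteq> E \<Longrightarrow> cl S \<subseteq> cl T"
  using cl_mono[of S "cl T"] cl_idem[of T] cl_subset[of T] by blast

lemma indep_subset: "indep I \<Longrightarrow> J \<subseteq> I \<Longrightarrow> indep J"
  unfolding indep_def using cl_mono[of "J - {x}" "I - {x}" for x] by blast

lemma indep_insert:
  assumes "indep J" "t \<in> E" "t \<notin> cl J"
  shows "indep (insert t J)"
  unfolding indep_def
proof (intro conjI ballI)
  show sub: "insert t J \<subseteq> E" using assms by (auto simp: indep_def)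
  fix y assume y: "y \<in> insert t J"
  have tJ: "t \<notin> J" using assms subset_cl[of J] by (auto simp: indep_def)
  show "y \<notin> cl (insert t J - {y})"
  proof (cases "y = t")
    case True
    then show ?thesis using assms tJ by simp
  next
    case False
    then have yJ: "y \<in> J" using y by simp
    have eq: "insert t J - {y} = insert t (J - {y})" using False by auto
    show ?thesis
    proof
      assume "y \<in> cl (insert t J - {y})"
      then have "t \<in> cl (insert y (J - {y}))"
        using exchange[of "J - {y}" y t] assms yJ sub unfolding eq by (auto simp: indep_def)
      then show False using assms(3) yJ by (simp add: insert_absorb)
    qed
  qed
qed

text \<open>Steinitz exchange: some \<open>x\<close> of \<open>I\<close> outside \<open>T\<close> is
  traded for a \<open>t\<close> in \<open>T\<close>, which keeps the cardinality and shrinks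
  \<open>I - T\<close>. A suitable \<open>t\<close> exists, since otherwise \<open>T\<close>, and
  with it \<open>x\<close>, would lie in the closure of \<open>I - {x}\<close>.\<close>

lemma card_indep_le:
  assumes "finite T" "T \<subseteq> E"
  shows "finite I \<Longrightarrow> indep I \<Longrightarrow> I \<subseteq> cl T \<Longrightarrow> card I \<le> card T"
proof (induction "card (I - T)" arbitrary: I rule: less_induct)
  case less
  show ?case
  proof (cases "I \<subseteq> T")
    case True
    then show ?thesis using assms card_mono by blast
  next
    case False
    then obtain x where x: "x \<in> I" "x \<notin> T" by blast
    let ?J = "I - {x}"
    have IE: "I \<subseteq> E" and xJ: "x \<notin> cl ?J" using less x by (auto simp: indep_def)
    have "\<not> T \<subseteq> cl ?J"
      using cl_least[of T ?J] less x xJ IE by blast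
    then obtain t where t: "t \<in> T" "t \<notin> cl ?J" by blast
    have tJ: "t \<notin> ?J" using t subset_cl[of ?J] IE by auto
    let ?I = "insert t ?J"
    have "indep ?I"
      using indep_insert[OF indep_subset[OF less.prems(2), of ?J]] t assms by auto
    moreover have "?I \<subseteq> cl T" using t subset_cl assms less by auto
    moreover have "card (?I - T) < card (I - T)"
    proof (rule psubset_card_mono)
      show "finite (I - T)" using less by simp
      show "?I - T \<subset> I - T" using t x by auto
    qed
    ultimately have "card ?I \<le> card T" using less by auto
    moreover have "card ?I = card I"
      using tJ less x card.remove[of I x] by simp
    ultimately show ?thesis by simp
  qed
qed

text \<open>An infinite \<open>I\<close> would contain an independent subset with
  \<open>card T + 1\<close> elements. For infinite \<open>T\<close> nothing has to be shown, because
  \<open>ecard\<close> does not distinguish infinite cardinals.\<close>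

lemma ecard_indep_le:
  assumes "T \<subseteq> E" "indep I" "I \<subseteq> cl T"
  shows "ecard I \<le> ecard T"
proof (cases "finite T")
  case True
  have "finite I"
  proof (rule ccontr)
    assume "infinite I"
    then obtain J where J: "J \<subseteq> I" "finite J" "card J = Suc (card T)"
      using infinite_arbitrarily_large by blast
    then show False
      using card_indep_le[of T J] True assms indep_subset by fastforce
  qed
  then show ?thesis using True assms card_indep_le by (simp add: ecard_def)
qed (simp add: ecard_def)

definition basis :: "'b set \<Rightarrow> 'b set \<Rightarrow> bool"
  where "basis S B \<longleftrightarrow> B \<subseteq> S \<and> indep B \<and> S \<subseteq> cl B"

lemma basis_ecard_unique:
  assumes "basis S B" "basis S C"
  shows "ecard B = ecard C"
  using assms ecard_indep_le[of B C] ecard_indep_le[of C B]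
  unfolding basis_def by (meson antisym indep_def order_trans)

text \<open>A dependence in the union has a finite witness, and a finite subset of the union already
  lies in one member of the chain. This feeds Zorn's lemma.\<close>

lemma indep_Union_chain:
  assumes "C \<noteq> {}" "\<forall>I\<in>C. indep I" "\<forall>X\<in>C. \<forall>Y\<in>C. X \<subseteq> Y \<or> Y \<subseteq> X"
  shows "indep (\<Union>C)"
  unfolding indep_def
proof (intro conjI ballI notI)
  show sub: "\<Union>C \<subseteq> E" using assms by (auto simp: indep_def)
  fix x assume x: "x \<in> \<Union>C" "x \<in> cl (\<Union>C - {x})"
  obtain T where T: "T \<subseteq> \<Union>C - {x}" "finite T" "x \<in> cl T"
    using finitary[OF _ x(2)] sub by blast
  have "subset.chain UNIV C" using assms(3) by (auto simp: subset.chain_def)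
  moreover have "insert x T \<subseteq> \<Union>C" using T x by auto
  ultimately obtain I where I: "I \<in> C" "insert x T \<subseteq> I"
    using finite_subset_Union_chain[of "insert x T" C UNIV] T assms(1) by auto
  then have "x \<in> cl (I - {x})"
    using cl_mono[of T "I - {x}"] T assms(2) unfolding indep_def by blast
  then show False using I assms(2) by (auto simp: indep_def)
qed

lemma basis_exists:
  assumes "S \<subseteq> E"
  shows "\<exists>B. basis S B"
proof -
  let ?A = "{I. I \<subseteq> S \<and> indep I}"
  have "\<exists>M\<in>?A. \<forall>X\<in>?A. M \<subseteq> X \<longrightarrow> X = M"
  proof (rule subset_Zorn_nonempty)
    show "?A \<noteq> {}" by (auto simp: indep_def)
    fix C assume C: "C \<noteq> {}" "subset.chain ?A C"
    then show "\<Union>C \<in> ?A"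
      using indep_Union_chain[of C] by (auto simp: subset.chain_def)
  qed
  then obtain M where M: "M \<subseteq> S" "indep M" and max: "\<forall>X\<in>?A. M \<subseteq> X \<longrightarrow> X = M" by auto
  have "S \<subseteq> cl M"
  proof
    fix x assume "x \<in> S"
    show "x \<in> cl M"
    proof (rule ccontr)
      assume "x \<notin> cl M"
      then have "insert x M = M"
        using M indep_insert[of M x] \<open>x \<in> S\<close> assms max[rule_format, of "insert x M"] by auto
      then show False using \<open>x \<notin> cl M\<close> subset_cl[of M] M assms by auto
    qed
  qed
  then show ?thesis using M by (auto simp: basis_def)
qed

end


section \<open>Principal left ideals in a 2-fir\<close>

lemma lideal_iff: "x \<in> lideal a \<longleftrightarrow> (\<exists>r. x = r * a)"
  by (auto simp: lideal_def)

lemma lideal_0 [simp]: "0 \<in> lideal a"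
  by (auto simp: lideal_iff intro: exI[of _ 0])

lemma lideal_self [simp]: "a \<in> lideal a"
  by (auto simp: lideal_iff intro: exI[of _ 1])

lemma lideal_mult_self [simp]: "r * a \<in> lideal a"
  by (auto simp: lideal_iff)

lemma lideal_add: "x \<in> lideal a \<Longrightarrow> y \<in> lideal a \<Longrightarrow> x + y \<in> lideal a"
  by (auto simp: lideal_iff simp flip: distrib_right)

lemma lideal_diff: "x \<in> lideal a \<Longrightarrow> y \<in> lideal a \<Longrightarrow> x - y \<in> lideal a"
  by (auto simp: lideal_iff simp flip: left_diff_distrib)

lemma lideal_mult: "x \<in> lideal a \<Longrightarrow> r * x \<in> lideal a"
  by (auto simp: lideal_iff simp flip: mult.assoc)

lemma lideal_add_iff: "y \<in> lideal a \<Longrightarrow> x + y \<in> lideal a \<longleftrightarrow> x \<in> lideal a"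
  using lideal_add lideal_diff by fastforce

lemma lideal_subset_iff: "lideal a \<subseteq> lideal b \<longleftrightarrow> a \<in> lideal b"
  by (metis lideal_iff lideal_mult lideal_self subset_iff)

lemma mult_eq_1_commute:
  fixes x :: "'a::ring_1_no_zero_divisors"
  assumes "x * y = 1"
  shows "y * x = 1"
proof -
  have "x \<noteq> 0" using assms by auto
  moreover have "x * (y * x) = x * 1" using assms by (simp flip: mult.assoc)
  ultimately show ?thesis using mult_left_cancel by blast
qed

text \<open>In a domain a one-sided inverse is two-sided, so units can be recognised from left
  ideals alone.\<close>

lemma ring_units_iff:
  fixes u :: "'a::ring_1_no_zero_divisors"
  shows "u \<in> ring_units \<longleftrightarrow> 1 \<in> lideal u"
  by (auto simp: ring_units_def lideal_iff) (metis mult_eq_1_commute)+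

lemma lideal_eq_UNIV_iff:
  fixes u :: "'a::ring_1_no_zero_divisors"
  shows "lideal u = UNIV \<longleftrightarrow> u \<in> ring_units"
  unfolding ring_units_iff by (metis UNIV_I UNIV_eq_I lideal_mult mult.right_neutral)

text \<open>
  The defining condition of a 2-fir is left-right symmetric. If \<open>ra = sb \<noteq> 0\<close>, cancelling the
  generator of \<open>rR + sR\<close> yields a comaximal relation \<open>r'x = s'y\<close> with \<open>a = xt\<close>, \<open>b = yt\<close>;
  completing \<open>(r', s')\<close> to an invertible matrix makes \<open>x\<close> and \<open>y\<close> left comaximal.
\<close>

lemma left_two_fir:
  fixes a b f :: "'a::two_fir"
  assumes "f \<noteq> 0" "f \<in> lideal a" "f \<in> lideal b"
  obtains c d where "lideal a \<inter> lideal b = lideal c"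
    and "\<And>x. x \<in> lideal d \<longleftrightarrow> (\<exists>r s. x = r * a + s * b)"
proof -
  obtain r where r: "f = r * a" using assms(2) unfolding lideal_iff by blast
  obtain s where s: "f = s * b" using assms(3) unfolding lideal_iff by blast
  note rs = r s
  then have nz: "r \<noteq> 0" "s \<noteq> 0" "a \<noteq> 0" "b \<noteq> 0" using assms(1) by auto
  have "f \<in> range (\<lambda>t. r * t) \<inter> range (\<lambda>t. s * t)" using rs by blast
  then have "range (\<lambda>t. r * t) \<inter> range (\<lambda>t. s * t) \<noteq> {0}" using assms(1) by blast
  from two_fir[OF this] obtain c d where
    c: "range (\<lambda>t. r * t) \<inter> range (\<lambda>t. s * t) = range (\<lambda>t. c * t)" and
    d: "{r * i + s * j |i j. True} = range (\<lambda>t. d * t)" by blast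
  have "r * 1 + s * 0 \<in> {r * i + s * j |i j. True}" by blast
  then obtain r' where r': "r = d * r'" using d by auto
  have "r * 0 + s * 1 \<in> {r * i + s * j |i j. True}" by blast
  then obtain s' where s': "s = d * s'" using d by auto
  have "d * 1 \<in> {r * i + s * j |i j. True}" using d by blast
  then obtain u v where uv: "d = r * u + s * v" by auto
  have d0: "d \<noteq> 0" using r' nz by auto
  have "d * 1 = d * (r' * u + s' * v)"
    using uv r' s' by (simp add: distrib_left flip: mult.assoc)
  then have one: "r' * u + s' * v = 1" using mult_left_cancel[OF d0] by metis
  \<comment> \<open>A pair \<open>(x, y)\<close> with \<open>c = r * x = s * y\<close> generates all
    solutions of \<open>r' * i = s' * j\<close>: multiplying by \<open>d\<close> gives a common
    right multiple of \<open>r\<close> and \<open>s\<close>, hence a multiple of \<open>c\<close>,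
    and \<open>r\<close>, \<open>s\<close> cancel.\<close>
  have in_c: "\<exists>w. i = x * w \<and> j = y * w"
    if "r' * i = s' * j" "c = r * x" "c = s * y" for i j x y
  proof -
    have eq: "r * i = s * j" using that(1) r' s' by (simp add: mult.assoc)
    have "r * i \<in> range (\<lambda>t. r * t) \<inter> range (\<lambda>t. s * t)"
      using eq by (metis IntI rangeI)
    then obtain w where w: "r * i = c * w" using c by auto
    then have "r * i = r * (x * w)" "s * j = s * (y * w)"
      using that eq by (simp_all flip: mult.assoc)
    then show ?thesis using nz by auto
  qed
  have "c * 1 \<in> range (\<lambda>t. r * t) \<inter> range (\<lambda>t. s * t)" using c by blast
  then obtain x y where "c * 1 = r * x" "c * 1 = s * y" by blast
  then have xy: "c = r * x" "c = s * y" by simp_all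
  then have "d * (r' * x) = d * (s' * y)" using r' s' by (simp flip: mult.assoc)
  then have rx: "r' * x = s' * y" using d0 by simp
  have "d * (r' * a) = d * (s' * b)" using rs r' s' by (simp flip: mult.assoc)
  then have ra: "r' * a = s' * b" using d0 by simp
  obtain t where t: "a = x * t" "b = y * t" using in_c[OF ra xy] by blast
  have x0: "x \<noteq> 0" using t nz by auto
  \<comment> \<open>From \<open>r' * u + s' * v = 1\<close> come two solutions of
    \<open>r' * i = s' * j\<close>, namely \<open>(1 - u * r', v * r')\<close> and
    \<open>(u * s', 1 - v * s')\<close>. Their factors \<open>w\<close> and \<open>z\<close> over
    \<open>(x, y)\<close> are the coefficients of the relation
    \<open>w * x + z * y = 1\<close>.\<close>
  have "r' * (1 - u * r') = (1 - r' * u) * r'" by (simp add: algebra_simps)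
  also have "1 - r' * u = s' * v" using one by (simp add: algebra_simps)
  finally have "r' * (1 - u * r') = s' * (v * r')" by (simp add: mult.assoc)
  from in_c[OF this xy] obtain w where w: "1 - u * r' = x * w" "v * r' = y * w" by blast
  have "s' * (1 - v * s') = (1 - s' * v) * s'" by (simp add: algebra_simps)
  also have "1 - s' * v = r' * u" using one by (simp add: algebra_simps)
  finally have "r' * (u * s') = s' * (1 - v * s')" by (simp add: mult.assoc)
  from in_c[OF this xy] obtain z where z: "u * s' = x * z" "1 - v * s' = y * z" by blast
  have "x * (w * x + z * y) = (1 - u * r') * x + (u * s') * y"
    unfolding w z by (simp add: algebra_simps)
  also have "\<dots> = x - u * (r' * x) + u * (s' * y)" by (simp add: algebra_simps)
  finally have "x * (w * x + z * y) = x * 1" using rx by simp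
  then have comax: "w * x + z * y = 1" using mult_left_cancel[OF x0] by blast
  show thesis
  proof
    show "lideal a \<inter> lideal b = lideal (r' * a)"
    proof (intro equalityI subsetI)
      fix k assume "k \<in> lideal a \<inter> lideal b"
      then obtain \<alpha> \<beta> where k: "k = \<alpha> * a" "k = \<beta> * b" unfolding lideal_iff Int_iff by blast
      then have "(\<alpha> * x) * t = (\<beta> * y) * t" using t by (simp add: mult.assoc)
      moreover have "t \<noteq> 0" using t nz by auto
      ultimately have e: "\<alpha> * x = \<beta> * y" by simp
      \<comment> \<open>The aim is that \<open>\<alpha>\<close> is a left multiple of
        \<open>r'\<close>: the summand \<open>\<alpha> * x * w\<close> equals
        \<open>\<beta> * y * w\<close>, and \<open>y * w = v * r'\<close>.\<close>
      have "\<alpha> = \<alpha> * (u * r' + x * w)" by (simp flip: w(1))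
      also have "\<dots> = \<alpha> * u * r' + (\<alpha> * x) * w" by (simp add: algebra_simps)
      also have "\<dots> = \<alpha> * u * r' + \<beta> * (y * w)" unfolding e by (simp add: mult.assoc)
      also have "\<dots> = (\<alpha> * u + \<beta> * v) * r'" unfolding w(2)[symmetric] by (simp add: algebra_simps)
      finally have "k = (\<alpha> * u + \<beta> * v) * (r' * a)" using k(1) by (metis mult.assoc)
      then show "k \<in> lideal (r' * a)" by simp
    next
      fix k assume "k \<in> lideal (r' * a)"
      then obtain m where "k = m * (r' * a)" by (auto simp: lideal_iff)
      then show "k \<in> lideal a \<inter> lideal b"
        by (metis IntI lideal_mult lideal_mult_self ra)
    qed
    show "k \<in> lideal t \<longleftrightarrow> (\<exists>r s. k = r * a + s * b)" for k
    proof
      assume "k \<in> lideal t"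
      then obtain m where "k = m * t" by (auto simp: lideal_iff)
      also have "\<dots> = m * ((w * x + z * y) * t)" using comax by simp
      also have "\<dots> = (m * w) * a + (m * z) * b" unfolding t by (simp add: algebra_simps)
      finally show "\<exists>r s. k = r * a + s * b" by blast
    next
      assume "\<exists>r s. k = r * a + s * b"
      then obtain i j where "k = i * a + j * b" by blast
      then have "k = (i * x + j * y) * t" unfolding t by (simp add: algebra_simps)
      then show "k \<in> lideal t" by simp
    qed
  qed
qed

text \<open>The common element \<open>f\<close> lies in every partial intersection, so
  \<open>left_two_fir\<close> stays applicable throughout the induction.\<close>

lemma INT_lideal_principal:
  fixes f :: "'a::two_fir"
  assumes "finite \<Gamma>" "f \<noteq> 0" "\<And>\<gamma>. \<gamma> \<in> \<Gamma> \<Longrightarrow> f \<in> lideal \<gamma>"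
  shows "\<exists>m. (\<Inter>\<gamma>\<in>\<Gamma>. lideal \<gamma>) = lideal m"
  using assms(1,3)
proof (induction rule: finite_induct)
  case empty
  have "lideal 1 = (UNIV :: 'a set)" by (auto simp: lideal_iff)
  then show ?case by auto
next
  case (insert \<gamma> \<Gamma>)
  then obtain m where m: "(\<Inter>\<gamma>\<in>\<Gamma>. lideal \<gamma>) = lideal m" by auto
  have fm: "f \<in> lideal m" unfolding m[symmetric] using insert.prems by simp
  have f\<gamma>: "f \<in> lideal \<gamma>" using insert.prems by simp
  obtain c where "lideal \<gamma> \<inter> lideal m = lideal c"
    by (rule left_two_fir[OF assms(2) f\<gamma> fm]) blast
  then show ?case using m by auto
qed


section \<open>Atoms and annihilators\<close>

lemma atoms_nonzero: "p \<in> atoms \<Longrightarrow> p \<noteq> 0"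
  and atoms_nonunit: "p \<in> atoms \<Longrightarrow> p \<notin> ring_units"
  by (auto simp: atoms_def)

text \<open>In \<open>p = e * q\<close> the factor \<open>e\<close> must be a unit. This is
  maximality among proper principal left ideals only; \<open>Rp\<close> need not be a maximal left
  ideal.\<close>

lemma atom_factor:
  assumes "p \<in> atoms" "p \<in> lideal q" "q \<notin> ring_units"
  shows "lideal q = lideal p"
proof -
  obtain e where e: "p = e * q" using assms by (auto simp: lideal_iff)
  then have "e \<in> ring_units" using assms by (auto simp: atoms_def)
  then obtain v where "v * e = 1" by (auto simp: ring_units_def)
  then have "q = v * p" using e by (metis mult.assoc mult_1)
  then have "q \<in> lideal p" by simp
  then show ?thesis using assms lideal_subset_iff by blast
qed

text \<open>The common multiple \<open>f\<close> makes \<open>Rp + Rg\<close> principal, and a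
  principal left ideal strictly above \<open>Rp\<close> is all of \<open>R\<close>.\<close>

lemma atom_comaximal:
  fixes p :: "'a::two_fir"
  assumes "p \<in> atoms" "f \<noteq> 0" "f \<in> lideal p" "f \<in> lideal g" "g \<notin> lideal p"
  obtains r s where "r * p + s * g = 1"
proof -
  obtain d where d: "\<And>x. x \<in> lideal d \<longleftrightarrow> (\<exists>r s. x = r * p + s * g)"
    using left_two_fir[of f p g] assms by blast
  have "g = 0 * p + 1 * g" "p = 1 * p + 0 * g" by auto
  then have "g \<in> lideal d" "p \<in> lideal d" using d by blast+
  then have "d \<in> ring_units" using atom_factor[OF assms(1)] assms(5) by blast
  then have "1 \<in> lideal d" by (simp add: ring_units_iff)
  then show thesis using d that by metis
qed

text \<open>The workhorse: a nonzero coset \<open>g + Rp\<close> killed by a nonzero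
  \<open>f\<close> generates \<open>R/Rp\<close>, and its annihilator is \<open>Rq\<close> with
  \<open>q\<close> an atom. So \<open>x + Rq\<close> goes to \<open>x * g + Rp\<close> under an
  isomorphism of \<open>R/Rq\<close> with \<open>R/Rp\<close>.\<close>

lemma annihilator_atom:
  fixes p g f :: "'a::two_fir"
  assumes p: "p \<in> atoms" and g: "g \<notin> lideal p" and f: "f \<noteq> 0" "f * g \<in> lideal p"
  obtains q h where "q \<in> atoms" "\<And>x. x * g \<in> lideal p \<longleftrightarrow> x \<in> lideal q" "h * g - 1 \<in> lideal p"
proof -
  have inv: "\<exists>h. h * y - 1 \<in> lideal p"
    if "y \<notin> lideal p" "e \<noteq> 0" "e * y \<in> lideal p" for e y
  proof -
    have "y \<noteq> 0" using that(1) by auto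
    have "e * y \<noteq> 0" using \<open>y \<noteq> 0\<close> that by simp
    then obtain r s where "r * p + s * y = 1"
      using atom_comaximal[OF p _ \<open>e * y \<in> lideal p\<close> lideal_mult_self \<open>y \<notin> lideal p\<close>] by blast
    then have "s * y - 1 = (- r) * p" by (simp add: algebra_simps)
    then show ?thesis by (metis lideal_mult_self)
  qed
  have g0: "g \<noteq> 0" using g by auto
  \<comment> \<open>\<open>q\<close> arises by cancelling \<open>g\<close> from the generator of the
    intersection of \<open>Rg\<close> and \<open>Rp\<close>.\<close>
  obtain m where m: "lideal g \<inter> lideal p = lideal m"
    using left_two_fir[OF _ lideal_mult_self f(2)] f(1) g0 by (metis mult_eq_0_iff)
  then have "m \<in> lideal g" using lideal_self by blast
  then obtain q where q: "m = q * g" by (auto simp: lideal_iff)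
  have ann: "x * g \<in> lideal p \<longleftrightarrow> x \<in> lideal q" for x
  proof -
    have "x * g \<in> lideal p \<longleftrightarrow> x * g \<in> lideal m" using m lideal_mult_self[of x g] by blast
    also have "\<dots> \<longleftrightarrow> x \<in> lideal q"
      unfolding q lideal_iff mult.assoc[symmetric] using g0 by simp
    finally show ?thesis .
  qed
  have "q \<in> atoms"
    unfolding atoms_def
  proof (intro CollectI conjI allI impI)
    show "q \<noteq> 0" using ann[of f] f by (auto simp: lideal_iff)
    then have q0: "q \<noteq> 0" .
    show "q \<notin> ring_units" using ann[of 1] g by (simp add: ring_units_iff)
    fix u v assume uv: "q = u * v"
    show "u \<in> ring_units \<or> v \<in> ring_units"
    proof (cases "v * g \<in> lideal p")
      case True
      then obtain w where "v = w * (u * v)" using ann uv by (auto simp: lideal_iff)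
      then have "1 * v = (w * u) * v" by (simp add: mult.assoc)
      moreover have "v \<noteq> 0" using uv q0 by auto
      ultimately have "1 = w * u" using mult_right_cancel by blast
      then show ?thesis by (auto simp: ring_units_iff lideal_iff)
    next
      case False
      have "u \<noteq> 0" "u * (v * g) \<in> lideal p"
        using ann[of q] q0 uv by (auto simp: mult.assoc)
      then obtain h where h: "h * (v * g) - 1 \<in> lideal p" using inv False by blast
      \<comment> \<open>Since \<open>v * g\<close> also generates \<open>R/Rp\<close>,
        \<open>g\<close> is congruent to \<open>g * h * (v * g)\<close>. Thus
        \<open>g * h * v - 1\<close> annihilates \<open>g\<close> and is a left multiple of
        \<open>u * v\<close>, which makes \<open>v\<close> left invertible.\<close>
      have "g * (h * (v * g) - 1) = (g * h * v - 1) * g" by (simp add: algebra_simps)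
      then have "g * h * v - 1 \<in> lideal q" using ann lideal_mult[OF h, of g] by simp
      then obtain k where "g * h * v - 1 = k * (u * v)" using uv by (auto simp: lideal_iff)
      then have "1 = (g * h - k * u) * v" by (simp add: algebra_simps)
      then show ?thesis by (auto simp: ring_units_iff lideal_iff)
    qed
  qed
  moreover obtain h where "h * g - 1 \<in> lideal p" using inv g f by blast
  ultimately show thesis using that ann by blast
qed


section \<open>Homomorphisms as right multiplications\<close>

lemma qcoset_iff: "z \<in> qcoset a x \<longleftrightarrow> z - x \<in> lideal a"
  by (auto simp: qcoset_def elt_set_plus_def) (metis add_diff_cancel_left' diff_add_cancel add.commute)

lemma qcoset_eq_iff: "qcoset a x = qcoset a y \<longleftrightarrow> x - y \<in> lideal a"
proof
  assume "qcoset a x = qcoset a y"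
  moreover have "x \<in> qcoset a x" by (simp add: qcoset_iff)
  ultimately show "x - y \<in> lideal a" by (simp add: qcoset_iff)
next
  assume xy: "x - y \<in> lideal a"
  have "z - x \<in> lideal a \<longleftrightarrow> z - y \<in> lideal a" for z
    using lideal_add_iff[OF xy, of "z - x"] by simp
  then show "qcoset a x = qcoset a y" by (auto simp: qcoset_iff)
qed

lemma lideal_eq_qcoset: "lideal a = qcoset a 0"
  by (auto simp: qcoset_iff)

lemma qcoset_in_qmod [simp]: "qcoset a x \<in> qmod a"
  by (simp add: qmod_def)

lemma qmodE:
  assumes "A \<in> qmod a"
  obtains x where "A = qcoset a x"
  using assms by (auto simp: qmod_def)

lemma lideal_mult_right: "x \<in> lideal a \<Longrightarrow> a * g \<in> lideal b \<Longrightarrow> x * g \<in> lideal b"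
  by (auto simp: lideal_iff) (metis mult.assoc)

lemma qhom_apply:
  assumes "\<phi> \<in> qhom a b" "\<phi> (qcoset a 1) = qcoset b g"
  shows "\<phi> (qcoset a x) = qcoset b (x * g)"
proof -
  have "\<phi> (qcoset a x) = \<phi> (qscale a x (qcoset a 1))" by (simp add: qscale_qcoset)
  also have "\<dots> = qscale b x (\<phi> (qcoset a 1))" using assms(1) by (simp add: qhom_def)
  finally show ?thesis by (simp add: assms(2) qscale_qcoset)
qed

text \<open>\<open>R/Ra\<close> is cyclic, so a homomorphism is determined by the image
  \<open>g + Rb\<close> of \<open>1 + Ra\<close>; well-definedness is the condition on
  \<open>a * g\<close>.\<close>

lemma qhom_rep:
  assumes "\<phi> \<in> qhom a b"
  obtains g where "\<And>x. \<phi> (qcoset a x) = qcoset b (x * g)" "a * g \<in> lideal b"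
proof -
  have "\<phi> (qcoset a 1) \<in> qmod b" using assms by (auto simp: qhom_def)
  then obtain g where g: "\<phi> (qcoset a 1) = qcoset b g" by (rule qmodE)
  note ap = qhom_apply[OF assms g]
  have "qcoset a a = qcoset a 0" by (simp add: qcoset_eq_iff)
  then have "qcoset b (a * g) = qcoset b (0 * g)" using ap by metis
  then have "a * g \<in> lideal b" by (simp add: qcoset_eq_iff)
  with ap show thesis by (rule that)
qed

text \<open>The condition on \<open>a * g\<close> makes the value independent of the representative
  picked by \<open>SOME\<close>. Extensionality is recorded so that for \<open>a = b\<close> the map
  belongs to \<open>qEnd\<close>.\<close>

lemma qhom_exists:
  assumes "a * g \<in> lideal b"
  shows "\<exists>\<phi>\<in>qhom a b \<inter> extensional (qmod a). \<forall>x. \<phi> (qcoset a x) = qcoset b (x * g)"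
proof -
  define \<phi> where "\<phi> = restrict (\<lambda>A. qcoset b ((SOME x. A = qcoset a x) * g)) (qmod a)"
  have \<phi>: "\<phi> (qcoset a x) = qcoset b (x * g)" for x
  proof -
    have "qcoset a x = qcoset a (SOME y. qcoset a x = qcoset a y)" by (rule someI) simp
    then have "(x - (SOME y. qcoset a x = qcoset a y)) * g \<in> lideal b"
      using lideal_mult_right assms by (auto simp only: qcoset_eq_iff)
    then have "qcoset b (x * g) = qcoset b ((SOME y. qcoset a x = qcoset a y) * g)"
      by (simp add: qcoset_eq_iff left_diff_distrib)
    then show ?thesis by (simp add: \<phi>_def)
  qed
  have "\<phi> \<in> qhom a b"
    unfolding qhom_def
  proof (intro CollectI conjI ballI allI)
    show "\<phi> \<in> qmod a \<rightarrow> qmod b" by (auto simp: \<phi> elim!: qmodE)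
    show "\<phi> (A + B) = \<phi> A + \<phi> B" if "A \<in> qmod a" "B \<in> qmod a" for A B
      using that by (auto simp: \<phi> qcoset_add distrib_right elim!: qmodE)
    show "\<phi> (qscale a r A) = qscale b r (\<phi> A)" if "A \<in> qmod a" for r A
      using that by (auto simp: \<phi> qscale_qcoset mult.assoc elim!: qmodE)
  qed
  moreover have "\<phi> \<in> extensional (qmod a)" by (simp add: \<phi>_def)
  ultimately show ?thesis using \<phi> by blast
qed

lemma qiso_rep:
  assumes "\<phi> \<in> qiso a b" "\<phi> (qcoset a 1) = qcoset b g"
  shows "x * g \<in> lideal b \<longleftrightarrow> x \<in> lideal a" and "\<exists>h. h * g - 1 \<in> lideal b"
proof -
  have hom: "\<phi> \<in> qhom a b" and bij: "bij_betw \<phi> (qmod a) (qmod b)"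
    using assms(1) by (auto simp: qiso_def)
  note ap = qhom_apply[OF hom assms(2)]
  have "x * g \<in> lideal b \<longleftrightarrow> \<phi> (qcoset a x) = \<phi> (qcoset a 0)"
    by (simp add: ap qcoset_eq_iff)
  also have "\<dots> \<longleftrightarrow> qcoset a x = qcoset a 0"
    using bij by (auto simp: bij_betw_def inj_on_eq_iff)
  finally show "x * g \<in> lideal b \<longleftrightarrow> x \<in> lideal a" by (simp add: qcoset_eq_iff)
  have "qcoset b 1 \<in> \<phi> ` qmod a" using bij by (simp add: bij_betw_def)
  then obtain h where "\<phi> (qcoset a h) = qcoset b 1" by (auto elim!: qmodE)
  then show "\<exists>h. h * g - 1 \<in> lideal b" by (auto simp: ap qcoset_eq_iff)
qed

text \<open>An isomorphism is right multiplication by some \<open>g\<close>: the equivalence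
  expresses that it is well defined and injective, the element \<open>h\<close> that
  \<open>g + Rb\<close> generates \<open>R/Rb\<close>. From here on similarity is computed with
  \<open>g\<close> and \<open>h\<close> alone.\<close>

lemma similar_elts_iff:
  "similar_elts a b \<longleftrightarrow> a \<noteq> 0 \<and> b \<noteq> 0 \<and>
    (\<exists>g h. (\<forall>x. x * g \<in> lideal b \<longleftrightarrow> x \<in> lideal a) \<and> h * g - 1 \<in> lideal b)"
proof -
  have "\<exists>g h. (\<forall>x. x * g \<in> lideal b \<longleftrightarrow> x \<in> lideal a) \<and> h * g - 1 \<in> lideal b"
    if "\<phi> \<in> qiso a b" for \<phi>
  proof -
    have "\<phi> (qcoset a 1) \<in> qmod b" using that by (auto simp: qiso_def qhom_def)
    then obtain g where "\<phi> (qcoset a 1) = qcoset b g" by (rule qmodE)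
    then show ?thesis using qiso_rep[OF that] by blast
  qed
  moreover have "qiso a b \<noteq> {}"
    if ann: "\<forall>x. x * g \<in> lideal b \<longleftrightarrow> x \<in> lideal a" and h: "h * g - 1 \<in> lideal b" for g h
  proof -
    have "a * g \<in> lideal b" using ann by simp
    then obtain \<phi> where \<phi>: "\<phi> \<in> qhom a b" "\<And>x. \<phi> (qcoset a x) = qcoset b (x * g)"
      using qhom_exists[of a g b] by auto
    have "inj_on \<phi> (qmod a)"
    proof (rule inj_onI)
      fix A B assume "A \<in> qmod a" "B \<in> qmod a" and eq: "\<phi> A = \<phi> B"
      then obtain x y where xy: "A = qcoset a x" "B = qcoset a y" by (auto elim!: qmodE)
      then have "(x - y) * g \<in> lideal b"
        using eq by (simp add: \<phi> qcoset_eq_iff left_diff_distrib)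
      then show "A = B" using ann by (simp add: xy qcoset_eq_iff)
    qed
    moreover have "\<phi> ` qmod a = qmod b"
    proof (intro equalityI subsetI)
      fix B assume "B \<in> qmod b"
      then obtain y where y: "B = qcoset b y" by (rule qmodE)
      have "y * (h * g - 1) \<in> lideal b" using h by (rule lideal_mult)
      then have "\<phi> (qcoset a (y * h)) = B"
        by (simp add: \<phi> y qcoset_eq_iff right_diff_distrib mult.assoc)
      then show "B \<in> \<phi> ` qmod a" by (metis imageI qcoset_in_qmod)
    qed (use \<phi>(1) in \<open>auto simp: qhom_def\<close>)
    ultimately show ?thesis using \<phi>(1) by (auto simp: qiso_def bij_betw_def)
  qed
  ultimately show ?thesis unfolding similar_elts_def by blast
qed

lemma similar_elts_cong_lideal:
  "lideal a = lideal b \<Longrightarrow> a \<noteq> 0 \<Longrightarrow> b \<noteq> 0 \<Longrightarrow> similar_elts a b"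
  unfolding similar_elts_iff by (intro conjI exI[of _ 1]) simp_all

lemma similar_elts_refl: "a \<noteq> 0 \<Longrightarrow> similar_elts a a"
  by (rule similar_elts_cong_lideal) auto

text \<open>Right multiplication by \<open>h\<close> is the inverse isomorphism, because
  \<open>x * h * g\<close> differs from \<open>x\<close> by \<open>x * (h * g - 1)\<close>, an
  element of \<open>Rb\<close>.\<close>

lemma similar_elts_sym:
  assumes "similar_elts a b"
  shows "similar_elts b a"
proof -
  obtain g h where ann: "\<And>x. x * g \<in> lideal b \<longleftrightarrow> x \<in> lideal a" and h: "h * g - 1 \<in> lideal b"
    using assms unfolding similar_elts_iff by blast
  have "x * h \<in> lideal a \<longleftrightarrow> x \<in> lideal b" for x
  proof -
    have "x * h \<in> lideal a \<longleftrightarrow> x + x * (h * g - 1) \<in> lideal b"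
      unfolding ann[symmetric] by (simp add: algebra_simps)
    also have "\<dots> \<longleftrightarrow> x \<in> lideal b" by (rule lideal_add_iff[OF lideal_mult[OF h]])
    finally show ?thesis .
  qed
  moreover have "g * h - 1 \<in> lideal a"
    using lideal_mult[OF h, of g] unfolding ann[symmetric] by (simp add: algebra_simps)
  ultimately show ?thesis using assms unfolding similar_elts_iff by blast
qed

lemma similar_elts_trans:
  assumes "similar_elts a b" "similar_elts b c"
  shows "similar_elts a c"
proof -
  obtain g h where ann: "\<And>x. x * g \<in> lideal b \<longleftrightarrow> x \<in> lideal a" and h: "h * g - 1 \<in> lideal b"
    using assms(1) unfolding similar_elts_iff by blast
  obtain g' h' where ann': "\<And>x. x * g' \<in> lideal c \<longleftrightarrow> x \<in> lideal b"
    and h': "h' * g' - 1 \<in> lideal c"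
    using assms(2) unfolding similar_elts_iff by blast
  have "x * (g * g') \<in> lideal c \<longleftrightarrow> x \<in> lideal a" for x
    using ann ann' by (simp flip: mult.assoc)
  moreover have "(h' * h) * (g * g') - 1 \<in> lideal c"
  proof -
    have "h' * (h * g - 1) * g' \<in> lideal c" using h ann' lideal_mult by blast
    then have "h' * (h * g - 1) * g' + (h' * g' - 1) \<in> lideal c" using h' by (rule lideal_add)
    then show ?thesis by (simp add: algebra_simps)
  qed
  ultimately show ?thesis using assms unfolding similar_elts_iff by blast
qed

lemma sim_class_iff: "b \<in> sim_class a \<longleftrightarrow> similar_elts a b"
  by (simp add: sim_class_def)


section \<open>\<open>F\<close>-dependence of atoms\<close>

lemma exchange_atoms:
  fixes \<gamma> \<delta> m f :: "'a::two_fir"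
  assumes atoms: "\<gamma> \<in> atoms" "\<delta> \<in> atoms"
    and f: "f \<noteq> 0" "f \<in> lideal m" "f \<in> lideal \<gamma>"
    and sub: "lideal m \<inter> lideal \<gamma> \<subseteq> lideal \<delta>" and m: "m \<notin> lideal \<delta>"
  shows "similar_elts \<gamma> \<delta>" and "lideal m \<inter> lideal \<delta> \<subseteq> lideal \<gamma>"
proof -
  obtain t where t: "f = t * m" using f by (auto simp: lideal_iff)
  have t0: "t \<noteq> 0" using t f by auto
  have m\<gamma>: "m \<notin> lideal \<gamma>" using sub m lideal_self by blast
  have t\<gamma>: "t * m \<in> lideal \<gamma>" and t\<delta>: "t * m \<in> lideal \<delta>" using f sub t by auto
  obtain q h where q: "q \<in> atoms" and ann: "\<And>x. x * m \<in> lideal \<gamma> \<longleftrightarrow> x \<in> lideal q"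
    and h: "h * m - 1 \<in> lideal \<gamma>"
    using annihilator_atom[OF atoms(1) m\<gamma> t0 t\<gamma>] by metis
  obtain q' h' where q': "q' \<in> atoms" and ann': "\<And>x. x * m \<in> lideal \<delta> \<longleftrightarrow> x \<in> lideal q'"
    and h': "h' * m - 1 \<in> lideal \<delta>"
    using annihilator_atom[OF atoms(2) m t0 t\<delta>] by metis
  \<comment> \<open>The hypothesis \<open>sub\<close> yields only that \<open>Rq\<close> lies in
    \<open>Rq'\<close>. Equality follows since both are atoms, and this equality is what allows
    \<open>\<gamma>\<close> and \<open>\<delta>\<close> to change places.\<close>
  have "q * m \<in> lideal \<gamma>" using ann by simp
  then have "q * m \<in> lideal \<delta>" using sub by auto
  then have "q \<in> lideal q'" using ann' by simp
  then have eq: "lideal q' = lideal q" using atom_factor q q' atoms_nonunit by blast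
  have "similar_elts q \<gamma>" "similar_elts q \<delta>"
    unfolding similar_elts_iff using ann h ann' h' eq atoms_nonzero atoms q by metis+
  then show "similar_elts \<gamma> \<delta>" using similar_elts_sym similar_elts_trans by blast
  show "lideal m \<inter> lideal \<delta> \<subseteq> lideal \<gamma>"
  proof
    fix x assume x: "x \<in> lideal m \<inter> lideal \<delta>"
    then obtain s where s: "x = s * m" by (auto simp: lideal_iff)
    then show "x \<in> lideal \<gamma>" using x ann ann' eq by simp
  qed
qed

text \<open>Members not similar to \<open>\<delta>\<close> are dropped one at a time. If the
  generator \<open>m\<close> of the remaining intersection were outside \<open>R\<delta>\<close>,
  then \<open>exchange_atoms\<close> would make the dropped atom similar to
  \<open>\<delta>\<close>.\<close>

lemma INT_similar_subset:
  fixes \<delta> f :: "'a::two_fir"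
  assumes "finite \<Gamma>" "\<Gamma> \<subseteq> atoms" "\<delta> \<in> atoms" "f \<noteq> 0" "\<And>\<gamma>. \<gamma> \<in> \<Gamma> \<Longrightarrow> f \<in> lideal \<gamma>"
    and "(\<Inter>\<gamma>\<in>\<Gamma>. lideal \<gamma>) \<subseteq> lideal \<delta>"
  shows "(\<Inter>\<gamma>\<in>\<Gamma> \<inter> sim_class \<delta>. lideal \<gamma>) \<subseteq> lideal \<delta>"
proof -
  have drop: "(\<Inter>\<gamma>\<in>\<Gamma> \<inter> sim_class \<delta> \<union> N. lideal \<gamma>) \<subseteq> lideal \<delta> \<Longrightarrow>
      (\<Inter>\<gamma>\<in>\<Gamma> \<inter> sim_class \<delta>. lideal \<gamma>) \<subseteq> lideal \<delta>"
    if "finite N" "N \<subseteq> \<Gamma> - sim_class \<delta>" for N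
    using that
  proof (induction rule: finite_induct)
    case (insert \<nu> N)
    let ?M = "\<Gamma> \<inter> sim_class \<delta> \<union> N"
    have sub: "?M \<subseteq> \<Gamma>" and \<nu>: "\<nu> \<in> \<Gamma>" "\<nu> \<notin> sim_class \<delta>" using insert by auto
    then have "finite ?M" using assms(1) finite_subset by blast
    then obtain m where m: "(\<Inter>\<gamma>\<in>?M. lideal \<gamma>) = lideal m"
      using INT_lideal_principal[of ?M f] assms(4,5) sub by blast
    have fm: "f \<in> lideal m" unfolding m[symmetric] using assms(5) sub by blast
    have "lideal m \<inter> lideal \<nu> \<subseteq> lideal \<delta>" unfolding m[symmetric] using insert.prems(1) by auto
    then have "m \<in> lideal \<delta>"
      using exchange_atoms(1)[of \<nu> \<delta> f m] \<nu> assms fm similar_elts_sym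
      unfolding sim_class_iff by blast
    then have "(\<Inter>\<gamma>\<in>?M. lideal \<gamma>) \<subseteq> lideal \<delta>" unfolding m lideal_subset_iff .
    then show ?case using insert.IH insert.prems(2) by blast
  qed simp
  have "\<Gamma> \<inter> sim_class \<delta> \<union> (\<Gamma> - sim_class \<delta>) = \<Gamma>" by blast
  then show ?thesis using drop[of "\<Gamma> - sim_class \<delta>"] assms(1,6) by simp
qed

lemma atoms_finite_length: "p \<in> atoms \<Longrightarrow> p \<in> finite_length"
proof -
  assume p: "p \<in> atoms"
  then have "product_of_atoms 1 p" unfolding product_of_atoms_def by (intro exI[of _ "[p]"]) simp
  then show ?thesis unfolding finite_length_def atomic_length_def by (auto simp: zero_enat_def)
qed

lemma F_algebraic_iff:
  assumes "S \<subseteq> atoms"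
  shows "F_algebraic S \<longleftrightarrow> (\<exists>f. f \<noteq> 0 \<and> (\<forall>\<delta>\<in>S. f \<in> lideal \<delta>))"
proof -
  have "S \<subseteq> finite_length - ring_units" using assms atoms_finite_length atoms_nonunit by blast
  moreover have "(0::'a) \<in> (\<Inter>\<delta>\<in>S. lideal \<delta>)" by simp
  ultimately show ?thesis unfolding F_algebraic_def by auto
qed

lemma F_algebraic_subset: "F_algebraic S \<Longrightarrow> S \<subseteq> atoms \<Longrightarrow> T \<subseteq> S \<Longrightarrow> F_algebraic T"
  by (meson F_algebraic_iff subset_eq)

text \<open>The finite intersection is some \<open>Rm\<close>, and by \<open>atom_comaximal\<close>
  the sum \<open>R\<delta> + Rm\<close> is \<open>R\<close> unless \<open>m\<close> lies in
  \<open>R\<delta>\<close>. Non-comaximality thus becomes inclusion, the form used from here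
  on.\<close>

lemma F_dependent_iff:
  fixes \<delta> :: "'a::two_fir"
  assumes "\<delta> \<in> atoms" "B \<subseteq> atoms"
  shows "F_dependent \<delta> B \<longleftrightarrow> F_algebraic (insert \<delta> B) \<and>
    (\<exists>\<Gamma>\<subseteq>B. finite \<Gamma> \<and> (\<Inter>\<gamma>\<in>\<Gamma>. lideal \<gamma>) \<subseteq> lideal \<delta>)"
proof -
  have "lideal \<delta> + (\<Inter>\<gamma>\<in>\<Gamma>. lideal \<gamma>) \<noteq> UNIV \<longleftrightarrow> (\<Inter>\<gamma>\<in>\<Gamma>. lideal \<gamma>) \<subseteq> lideal \<delta>"
    if alg: "F_algebraic (insert \<delta> B)" and \<Gamma>: "\<Gamma> \<subseteq> B" "finite \<Gamma>" for \<Gamma>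
  proof
    assume sub: "(\<Inter>\<gamma>\<in>\<Gamma>. lideal \<gamma>) \<subseteq> lideal \<delta>"
    have "lideal \<delta> + (\<Inter>\<gamma>\<in>\<Gamma>. lideal \<gamma>) \<subseteq> lideal \<delta>"
      using sub lideal_add by (blast elim!: set_plus_elim)
    then show "lideal \<delta> + (\<Inter>\<gamma>\<in>\<Gamma>. lideal \<gamma>) \<noteq> UNIV"
      using lideal_eq_UNIV_iff[of \<delta>] atoms_nonunit[OF assms(1)] by blast
  next
    assume ne: "lideal \<delta> + (\<Inter>\<gamma>\<in>\<Gamma>. lideal \<gamma>) \<noteq> UNIV"
    obtain f where f: "f \<noteq> 0" "\<forall>\<gamma>\<in>insert \<delta> B. f \<in> lideal \<gamma>"
      using alg F_algebraic_iff[of "insert \<delta> B"] assms by blast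
    obtain m where m: "(\<Inter>\<gamma>\<in>\<Gamma>. lideal \<gamma>) = lideal m"
      using INT_lideal_principal[of \<Gamma> f] f \<Gamma> by blast
    have fm: "f \<in> lideal m" unfolding m[symmetric] using f \<Gamma> by blast
    have "m \<in> lideal \<delta>"
    proof (rule ccontr)
      assume "m \<notin> lideal \<delta>"
      then obtain r s where rs: "r * \<delta> + s * m = 1"
        using atom_comaximal[OF assms(1) f(1) _ fm] f(2) by blast
      have "x \<in> lideal \<delta> + lideal m" for x
      proof -
        have "x = (x * r) * \<delta> + (x * s) * m"
          using arg_cong[OF rs, of "\<lambda>y. x * y"] by (simp add: algebra_simps)
        then show ?thesis by (metis lideal_mult_self set_plus_intro)
      qed
      then have "lideal \<delta> + lideal m = UNIV" by blast
      then show False using ne m by simp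
    qed
    then show "(\<Inter>\<gamma>\<in>\<Gamma>. lideal \<gamma>) \<subseteq> lideal \<delta>" using m lideal_subset_iff by metis
  qed
  then have "F_algebraic (insert \<delta> B) \<Longrightarrow>
      (\<exists>\<Gamma>\<subseteq>B. finite \<Gamma> \<and> lideal \<delta> + (\<Inter>\<gamma>\<in>\<Gamma>. lideal \<gamma>) \<noteq> UNIV) \<longleftrightarrow>
      (\<exists>\<Gamma>\<subseteq>B. finite \<Gamma> \<and> (\<Inter>\<gamma>\<in>\<Gamma>. lideal \<gamma>) \<subseteq> lideal \<delta>)"
    by (intro ex_cong1 conj_cong refl)
  then show ?thesis
    using atoms_finite_length[OF assms(1)] by (auto simp only: F_dependent_def)
qed

lemma F_dependent_iff_within:
  fixes \<Delta> :: "'a::two_fir set"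
  assumes "F_algebraic \<Delta>" "\<Delta> \<subseteq> atoms" "B \<subseteq> \<Delta>" "\<delta> \<in> \<Delta>"
  shows "F_dependent \<delta> B \<longleftrightarrow> (\<exists>\<Gamma>\<subseteq>B. finite \<Gamma> \<and> (\<Inter>\<gamma>\<in>\<Gamma>. lideal \<gamma>) \<subseteq> lideal \<delta>)"
proof -
  have "F_algebraic (insert \<delta> B)" using F_algebraic_subset[OF assms(1,2)] assms by blast
  moreover have "\<delta> \<in> atoms" "B \<subseteq> atoms" using assms by auto
  ultimately show ?thesis using F_dependent_iff[of \<delta> B] by simp
qed

text \<open>\<open>\<Gamma>\<close> is nonempty because the empty intersection \<open>R\<close> does
  not fit into \<open>R\<delta>\<close>. An element of \<open>\<Gamma>\<close> later identifies the
  class in which \<open>\<delta>\<close> lies.\<close>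

lemma F_dependent_similar:
  fixes \<delta> :: "'a::two_fir"
  assumes "F_dependent \<delta> B" "\<delta> \<in> atoms" "B \<subseteq> atoms"
  shows "\<exists>\<Gamma>\<subseteq>B \<inter> sim_class \<delta>. finite \<Gamma> \<and> \<Gamma> \<noteq> {} \<and> (\<Inter>\<gamma>\<in>\<Gamma>. lideal \<gamma>) \<subseteq> lideal \<delta>"
proof -
  obtain \<Gamma> where \<Gamma>: "\<Gamma> \<subseteq> B" "finite \<Gamma>" "(\<Inter>\<gamma>\<in>\<Gamma>. lideal \<gamma>) \<subseteq> lideal \<delta>"
    and "F_algebraic (insert \<delta> B)"
    using assms F_dependent_iff[of \<delta> B] by auto
  then obtain f where f: "f \<noteq> 0" "\<forall>\<gamma>\<in>B. f \<in> lideal \<gamma>"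
    using F_algebraic_iff[of "insert \<delta> B"] assms by auto
  have "\<Gamma> \<subseteq> atoms" "\<And>\<gamma>. \<gamma> \<in> \<Gamma> \<Longrightarrow> f \<in> lideal \<gamma>" using \<Gamma>(1) assms(3) f(2) by auto
  then have sub: "(\<Inter>\<gamma>\<in>\<Gamma> \<inter> sim_class \<delta>. lideal \<gamma>) \<subseteq> lideal \<delta>"
    using INT_similar_subset[OF \<Gamma>(2) _ assms(2) f(1) _ \<Gamma>(3)] by blast
  moreover have "\<Gamma> \<inter> sim_class \<delta> \<noteq> {}"
  proof
    assume "\<Gamma> \<inter> sim_class \<delta> = {}"
    then have "lideal \<delta> = UNIV" using sub by auto
    then show False using assms(2) atoms_nonunit lideal_eq_UNIV_iff by blast
  qed
  ultimately show ?thesis using \<Gamma> by (intro exI[of _ "\<Gamma> \<inter> sim_class \<delta>"]) auto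
qed

text \<open>Inside a fixed F-algebraic \<open>\<Delta>\<close> the algebraicity clause of dependence
  is automatic and only the inclusion of ideals remains. Exchange is then
  \<open>exchange_atoms\<close>, with \<open>m\<close> generating a finite intersection.\<close>

lemma pregeometry_F:
  fixes \<Delta> :: "'a::two_fir set"
  assumes alg: "F_algebraic \<Delta>" and at: "\<Delta> \<subseteq> atoms"
  shows "pregeometry \<Delta> (\<lambda>B. {\<delta> \<in> \<Delta>. F_dependent \<delta> B})"
proof -
  note dep = F_dependent_iff_within[OF alg at]
  obtain f where f: "f \<noteq> 0" "\<And>\<gamma>. \<gamma> \<in> \<Delta> \<Longrightarrow> f \<in> lideal \<gamma>"
    using alg F_algebraic_iff[OF at] by auto
  show ?thesis
  proof
    fix S assume S: "S \<subseteq> \<Delta>"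
    show "{\<delta> \<in> \<Delta>. F_dependent \<delta> S} \<subseteq> \<Delta>" by blast
    show "S \<subseteq> {\<delta> \<in> \<Delta>. F_dependent \<delta> S}"
    proof
      fix \<delta> assume "\<delta> \<in> S"
      then have "{\<delta>} \<subseteq> S" "finite {\<delta>}" "(\<Inter>\<gamma>\<in>{\<delta>}. lideal \<gamma>) \<subseteq> lideal \<delta>" by auto
      then show "\<delta> \<in> {\<delta> \<in> \<Delta>. F_dependent \<delta> S}" using dep[OF S] S \<open>\<delta> \<in> S\<close> by blast
    qed
    show "{\<delta> \<in> \<Delta>. F_dependent \<delta> {\<delta> \<in> \<Delta>. F_dependent \<delta> S}} \<subseteq> {\<delta> \<in> \<Delta>. F_dependent \<delta> S}"
    proof
      fix \<delta> assume "\<delta> \<in> {\<delta> \<in> \<Delta>. F_dependent \<delta> {\<delta> \<in> \<Delta>. F_dependent \<delta> S}}"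
      then have \<delta>: "\<delta> \<in> \<Delta>" "F_dependent \<delta> {\<delta> \<in> \<Delta>. F_dependent \<delta> S}" by auto
      then obtain \<Gamma> where \<Gamma>: "\<Gamma> \<subseteq> {\<delta> \<in> \<Delta>. F_dependent \<delta> S}" "finite \<Gamma>"
        "(\<Inter>\<gamma>\<in>\<Gamma>. lideal \<gamma>) \<subseteq> lideal \<delta>"
        using dep[of "{\<delta> \<in> \<Delta>. F_dependent \<delta> S}" \<delta>] by auto
      then have "\<forall>\<gamma>\<in>\<Gamma>. \<exists>T\<subseteq>S. finite T \<and> (\<Inter>\<gamma>\<in>T. lideal \<gamma>) \<subseteq> lideal \<gamma>"
        using dep[OF S] by blast
      then obtain T where T: "\<forall>\<gamma>\<in>\<Gamma>. T \<gamma> \<subseteq> S \<and> finite (T \<gamma>) \<and> (\<Inter>\<gamma>\<in>T \<gamma>. lideal \<gamma>) \<subseteq> lideal \<gamma>"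
        by metis
      let ?T = "\<Union>\<gamma>\<in>\<Gamma>. T \<gamma>"
      have "?T \<subseteq> S" "finite ?T" using T \<Gamma> by auto
      moreover have "(\<Inter>\<gamma>\<in>?T. lideal \<gamma>) \<subseteq> (\<Inter>\<gamma>\<in>\<Gamma>. lideal \<gamma>)"
      proof (rule INT_greatest)
        fix \<gamma> assume "\<gamma> \<in> \<Gamma>"
        then have "(\<Inter>\<gamma>\<in>?T. lideal \<gamma>) \<subseteq> (\<Inter>\<gamma>\<in>T \<gamma>. lideal \<gamma>)" by (intro INF_superset_mono) auto
        then show "(\<Inter>\<gamma>\<in>?T. lideal \<gamma>) \<subseteq> lideal \<gamma>" using T \<open>\<gamma> \<in> \<Gamma>\<close> order_trans by metis
      qed
      ultimately have "\<exists>T\<subseteq>S. finite T \<and> (\<Inter>\<gamma>\<in>T. lideal \<gamma>) \<subseteq> lideal \<delta>"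
        using \<Gamma>(3) by (intro exI[of _ ?T] conjI) simp_all
      from iffD2[OF dep[OF S \<delta>(1)] this] show "\<delta> \<in> {\<delta> \<in> \<Delta>. F_dependent \<delta> S}"
        using \<delta>(1) by simp
    qed
    show "\<exists>T\<subseteq>S. finite T \<and> \<delta> \<in> {\<delta> \<in> \<Delta>. F_dependent \<delta> T}"
      if "\<delta> \<in> {\<delta> \<in> \<Delta>. F_dependent \<delta> S}" for \<delta>
    proof -
      have d: "\<delta> \<in> \<Delta>" "F_dependent \<delta> S" using that by auto
      obtain \<Gamma> where \<Gamma>: "\<Gamma> \<subseteq> S" "finite \<Gamma>" "(\<Inter>\<gamma>\<in>\<Gamma>. lideal \<gamma>) \<subseteq> lideal \<delta>"
        using iffD1[OF dep[OF S d(1)] d(2)] by (elim exE conjE)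
      have "\<exists>T\<subseteq>\<Gamma>. finite T \<and> (\<Inter>\<gamma>\<in>T. lideal \<gamma>) \<subseteq> lideal \<delta>"
        by (intro exI[of _ \<Gamma>] conjI subset_refl \<Gamma>)
      from iffD2[OF dep[OF order_trans[OF \<Gamma>(1) S] d(1)] this] show ?thesis
        using \<Gamma>(1,2) d(1) by (intro exI[of _ \<Gamma>]) simp
    qed
    show "y \<in> {\<delta> \<in> \<Delta>. F_dependent \<delta> (insert x S)}"
      if xy: "x \<in> \<Delta>" "y \<in> \<Delta>" and dx: "x \<in> {\<delta> \<in> \<Delta>. F_dependent \<delta> (insert y S)}"
        and nd: "x \<notin> {\<delta> \<in> \<Delta>. F_dependent \<delta> S}" for x y
    proof -
      obtain \<Gamma> where \<Gamma>: "\<Gamma> \<subseteq> insert y S" "finite \<Gamma>" "(\<Inter>\<gamma>\<in>\<Gamma>. lideal \<gamma>) \<subseteq> lideal x"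
        using iffD1[OF dep[of "insert y S" x]] dx S xy by auto
      \<comment> \<open>The witness must use \<open>y\<close>: without it the generator
        \<open>m\<close> of the intersection avoids \<open>Rx\<close>, since \<open>x\<close> does
        not depend on \<open>S\<close>.\<close>
      let ?G = "\<Gamma> - {y}"
      have G: "?G \<subseteq> S" "finite ?G" using \<Gamma> by auto
      then obtain m where m: "(\<Inter>\<gamma>\<in>?G. lideal \<gamma>) = lideal m"
        using INT_lideal_principal[of ?G f] f S by blast
      have fm: "f \<in> lideal m" unfolding m[symmetric] using f G S by blast
      have sub: "lideal m \<inter> lideal y \<subseteq> lideal x" unfolding m[symmetric] using \<Gamma>(3) by blast
      have mx: "m \<notin> lideal x"
      proof
        assume "m \<in> lideal x"
        then have "(\<Inter>\<gamma>\<in>?G. lideal \<gamma>) \<subseteq> lideal x" using m lideal_subset_iff by metis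
        then have "\<exists>T\<subseteq>S. finite T \<and> (\<Inter>\<gamma>\<in>T. lideal \<gamma>) \<subseteq> lideal x"
          using G by (intro exI[of _ ?G] conjI)
        then have "F_dependent x S" by (rule iffD2[OF dep[OF S xy(1)]])
        then show False using nd xy by blast
      qed
      have "lideal m \<inter> lideal x \<subseteq> lideal y"
        using exchange_atoms(2)[OF _ _ f(1) fm _ sub mx] xy at f by blast
      then have "(\<Inter>\<gamma>\<in>insert x ?G. lideal \<gamma>) \<subseteq> lideal y" using m by auto
      moreover have "insert x ?G \<subseteq> insert x S" "finite (insert x ?G)" using G by auto
      ultimately have "\<exists>T\<subseteq>insert x S. finite T \<and> (\<Inter>\<gamma>\<in>T. lideal \<gamma>) \<subseteq> lideal y"
        by (intro exI[of _ "insert x ?G"] conjI)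
      moreover have "insert x S \<subseteq> \<Delta>" using xy S by simp
      ultimately have "F_dependent y (insert x S)" using iffD2[OF dep[OF _ xy(2)]] by simp
      then show ?thesis using xy by blast
    qed
  next
    fix S T assume ST: "S \<subseteq> T" "T \<subseteq> \<Delta>"
    have "F_dependent \<delta> T" if "\<delta> \<in> \<Delta>" "F_dependent \<delta> S" for \<delta>
      using dep[of S \<delta>] dep[of T \<delta>] ST that by (meson order_trans)
    then show "{\<delta> \<in> \<Delta>. F_dependent \<delta> S} \<subseteq> {\<delta> \<in> \<Delta>. F_dependent \<delta> T}" by blast
  qed
qed


section \<open>The right \<open>C(p)\<close>-space \<open>R/Rp\<close>\<close>

text \<open>By \<open>qhom_rep\<close> and \<open>qhom_exists\<close> the endomorphisms are the
  right multiplications by those \<open>g\<close> with \<open>p * g\<close> in \<open>Rp\<close>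
  (the idealizer of \<open>Rp\<close>). This replaces functions on cosets by ring elements.\<close>

lemma C_subspace_iff:
  "C_subspace p W \<longleftrightarrow> W \<subseteq> qmod p \<and> qcoset p 0 \<in> W \<and>
    (\<forall>x y. qcoset p x \<in> W \<longrightarrow> qcoset p y \<in> W \<longrightarrow> qcoset p (x + y) \<in> W) \<and>
    (\<forall>x g. qcoset p x \<in> W \<longrightarrow> p * g \<in> lideal p \<longrightarrow> qcoset p (x * g) \<in> W)"
    (is "?L \<longleftrightarrow> ?R")
proof
  assume L: ?L
  have "qcoset p (x * g) \<in> W" if x: "qcoset p x \<in> W" and g: "p * g \<in> lideal p" for x g
  proof -
    obtain c where "c \<in> qhom p p \<inter> extensional (qmod p)" "\<forall>x. c (qcoset p x) = qcoset p (x * g)"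
      using qhom_exists[OF g] by blast
    then show ?thesis using L x unfolding C_subspace_def qEnd_def by metis
  qed
  moreover have "qcoset p (x + y) \<in> W" if "qcoset p x \<in> W" "qcoset p y \<in> W" for x y
    using L that unfolding C_subspace_def qcoset_add[symmetric] by blast
  ultimately show ?R using L by (auto simp: C_subspace_def lideal_eq_qcoset)
next
  assume R: ?R
  have "A + B \<in> W" if AB: "A \<in> W" "B \<in> W" for A B
  proof -
    obtain x where x: "A = qcoset p x" using AB R qmodE by blast
    obtain y where y: "B = qcoset p y" using AB R qmodE by blast
    show ?thesis using R AB unfolding x y qcoset_add by blast
  qed
  moreover have "c A \<in> W" if c: "c \<in> qEnd p" and A: "A \<in> W" for c A
  proof -
    obtain x where x: "A = qcoset p x" using A R qmodE by blast
    have "c \<in> qhom p p" using c by (simp add: qEnd_def)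
    then obtain g where "\<And>x. c (qcoset p x) = qcoset p (x * g)" "p * g \<in> lideal p"
      by (rule qhom_rep) blast
    then show ?thesis using R A unfolding x by simp
  qed
  ultimately show ?L using R unfolding C_subspace_def lideal_eq_qcoset by blast
qed

lemma C_subspace_qmod: "C_subspace p (qmod p)"
  by (simp add: C_subspace_iff)

section \<open>Span over \<open>C(p)\<close> as a closure operator\<close>

lemma C_span_superset: "S \<subseteq> C_span p S"
  unfolding C_span_def by (rule hull_subset)

lemma C_span_mono: "S \<subseteq> T \<Longrightarrow> C_span p S \<subseteq> C_span p T"
  unfolding C_span_def by (rule hull_mono)

lemma C_span_minimal: "S \<subseteq> W \<Longrightarrow> C_subspace p W \<Longrightarrow> C_span p S \<subseteq> W"
  unfolding C_span_def by (rule hull_minimal)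

lemma C_span_subset_qmod: "S \<subseteq> qmod p \<Longrightarrow> C_span p S \<subseteq> qmod p"
  by (intro C_span_minimal C_subspace_qmod)

lemma C_span_subspace:
  assumes "S \<subseteq> qmod p"
  shows "C_subspace p (C_span p S)"
proof -
  have mem: "A \<in> C_span p S \<longleftrightarrow> (\<forall>W. C_subspace p W \<longrightarrow> S \<subseteq> W \<longrightarrow> A \<in> W)" for A
    unfolding C_span_def hull_def by blast
  show ?thesis
    unfolding C_subspace_def
  proof (intro conjI ballI)
    show "C_span p S \<subseteq> qmod p" using assms by (rule C_span_subset_qmod)
    show "lideal p \<in> C_span p S" unfolding mem by (simp add: C_subspace_def)
    show "A + B \<in> C_span p S" if "A \<in> C_span p S" "B \<in> C_span p S" for A B
      using that unfolding mem by (simp add: C_subspace_def)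
    show "c A \<in> C_span p S" if "c \<in> qEnd p" "A \<in> C_span p S" for c A
      using that unfolding mem by (simp add: C_subspace_def)
  qed
qed

lemma C_span_eqI: "S \<subseteq> C_span p T \<Longrightarrow> T \<subseteq> C_span p S \<Longrightarrow> S \<subseteq> qmod p \<Longrightarrow> T \<subseteq> qmod p \<Longrightarrow>
    C_span p S = C_span p T"
  by (intro equalityI C_span_minimal C_span_subspace)

context
  fixes p :: "'a::ring_1" and S :: "'a set set"
  assumes S: "S \<subseteq> qmod p"
begin

lemma C_span_zero: "qcoset p 0 \<in> C_span p S"
  using C_span_subspace[OF S] by (simp add: C_subspace_iff)

lemma C_span_add:
  "qcoset p x \<in> C_span p S \<Longrightarrow> qcoset p y \<in> C_span p S \<Longrightarrow> qcoset p (x + y) \<in> C_span p S"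
  using C_span_subspace[OF S] by (simp add: C_subspace_iff)

lemma C_span_mult: "qcoset p x \<in> C_span p S \<Longrightarrow> p * g \<in> lideal p \<Longrightarrow> qcoset p (x * g) \<in> C_span p S"
  using C_span_subspace[OF S] by (simp add: C_subspace_iff)

lemma C_span_diff:
  assumes "qcoset p x \<in> C_span p S" "qcoset p y \<in> C_span p S"
  shows "qcoset p (x - y) \<in> C_span p S"
proof -
  have "p * (- 1) = (- 1) * p" by simp
  then have "p * (- 1) \<in> lideal p" by (metis lideal_mult_self)
  then have "qcoset p (y * (- 1)) \<in> C_span p S" by (rule C_span_mult[OF assms(2)])
  then show ?thesis using C_span_add[OF assms(1)] by fastforce
qed

text \<open>The spans of the finite subsets of \<open>S\<close> form a directed family, so their
  union is already a subspace.\<close>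

lemma C_span_finitary:
  assumes "A \<in> C_span p S"
  shows "\<exists>T\<subseteq>S. finite T \<and> A \<in> C_span p T"
proof -
  define U where "U = \<Union>(C_span p ` {T. T \<subseteq> S \<and> finite T})"
  have U: "A \<in> U \<longleftrightarrow> (\<exists>T\<subseteq>S. finite T \<and> A \<in> C_span p T)" for A unfolding U_def by blast
  have "C_subspace p U"
    unfolding C_subspace_def
  proof (intro conjI ballI)
    show "U \<subseteq> qmod p"
      using S C_span_subset_qmod unfolding U_def by (intro UN_least) blast
    show "lideal p \<in> U"
      unfolding U using C_span_subspace[of "{}" p]
      by (intro exI[of _ "{}"]) (simp add: C_subspace_def)
    show "A + B \<in> U" if AB: "A \<in> U" "B \<in> U" for A B
    proof -
      obtain T T' where T: "T \<subseteq> S" "finite T" "A \<in> C_span p T"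
        and T': "T' \<subseteq> S" "finite T'" "B \<in> C_span p T'" using AB unfolding U by blast
      have "A \<in> C_span p (T \<union> T')" "B \<in> C_span p (T \<union> T')"
        using T T' C_span_mono[of T "T \<union> T'" p] C_span_mono[of T' "T \<union> T'" p] by auto
      then have "A + B \<in> C_span p (T \<union> T')"
        using C_span_subspace[of "T \<union> T'" p] S T T' unfolding C_subspace_def by auto
      then show ?thesis unfolding U using T T' by (intro exI[of _ "T \<union> T'"]) simp
    qed
    show "c A \<in> U" if c: "c \<in> qEnd p" and A: "A \<in> U" for c A
    proof -
      obtain T where T: "T \<subseteq> S" "finite T" "A \<in> C_span p T" using A unfolding U by blast
      then have "c A \<in> C_span p T"
        using C_span_subspace[of T p] S c unfolding C_subspace_def by auto
      then show ?thesis unfolding U using T by (intro exI[of _ T]) simp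
    qed
  qed
  moreover have "S \<subseteq> U"
  proof
    fix A assume "A \<in> S"
    then show "A \<in> U" unfolding U using C_span_superset[of "{A}" p] by (intro exI[of _ "{A}"]) simp
  qed
  ultimately have "A \<in> U" using assms C_span_minimal by blast
  then show ?thesis using U by simp
qed

text \<open>The sum of the span of \<open>S\<close> and \<open>y C(p)\<close> is a subspace
  containing all generators, so it contains the span of the enlarged set.\<close>

lemma C_span_insert:
  assumes "qcoset p z \<in> C_span p (insert (qcoset p y) S)"
  shows "\<exists>g. p * g \<in> lideal p \<and> qcoset p (z - y * g) \<in> C_span p S"
proof -
  define P where "P z \<longleftrightarrow> (\<exists>g. p * g \<in> lideal p \<and> qcoset p (z - y * g) \<in> C_span p S)" for z
  define W where "W = qcoset p ` Collect P"
  \<comment> \<open>\<open>P\<close> is phrased with a representative; it depends only on the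
    coset.\<close>
  have W: "qcoset p z \<in> W \<longleftrightarrow> P z" for z
  proof
    assume "qcoset p z \<in> W"
    then obtain z' where z': "P z'" "qcoset p z = qcoset p z'" by (auto simp: W_def)
    then have "qcoset p (z - k) = qcoset p (z' - k)" for k by (simp add: qcoset_eq_iff)
    then show "P z" using z'(1) unfolding P_def by simp
  qed (simp add: W_def)
  have "C_subspace p W"
    unfolding C_subspace_iff W
  proof (intro conjI allI impI)
    show "W \<subseteq> qmod p" by (auto simp: W_def)
    show "P 0" unfolding P_def using C_span_zero by (intro exI[of _ 0]) simp
    show "P (x + x')" if px: "P x" "P x'" for x x'
    proof -
      obtain g g' where g: "p * g \<in> lideal p" "qcoset p (x - y * g) \<in> C_span p S"
        and g': "p * g' \<in> lideal p" "qcoset p (x' - y * g') \<in> C_span p S"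
        using px unfolding P_def by blast
      have "p * (g + g') \<in> lideal p" using lideal_add[OF g(1) g'(1)] by (simp add: distrib_left)
      moreover have "qcoset p ((x - y * g) + (x' - y * g')) \<in> C_span p S"
        using g g' by (intro C_span_add)
      then have "qcoset p ((x + x') - y * (g + g')) \<in> C_span p S" by (simp add: algebra_simps)
      ultimately show ?thesis unfolding P_def by blast
    qed
    show "P (x * k)" if px: "P x" and k: "p * k \<in> lideal p" for x k
    proof -
      obtain g where g: "p * g \<in> lideal p" "qcoset p (x - y * g) \<in> C_span p S"
        using px unfolding P_def by blast
      have "p * (g * k) \<in> lideal p"
        using lideal_mult_right[OF g(1) k] by (simp add: mult.assoc)
      moreover have "qcoset p ((x - y * g) * k) \<in> C_span p S" using g k by (intro C_span_mult)
      then have "qcoset p (x * k - y * (g * k)) \<in> C_span p S" by (simp add: algebra_simps)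
      ultimately show ?thesis unfolding P_def by blast
    qed
  qed
  moreover have "insert (qcoset p y) S \<subseteq> W"
  proof (rule insert_subsetI)
    have "P y" unfolding P_def using C_span_zero by (intro exI[of _ 1]) simp
    then show "qcoset p y \<in> W" using W by simp
    show "S \<subseteq> W"
    proof
      fix A assume A: "A \<in> S"
      then obtain x where x: "A = qcoset p x" using S qmodE by blast
      have "P x" unfolding P_def using A C_span_superset[of S p] x by (intro exI[of _ 0]) auto
      then show "A \<in> W" using W x by simp
    qed
  qed
  ultimately have "qcoset p z \<in> W" using assms C_span_minimal by blast
  then show ?thesis unfolding W P_def .
qed

end

text \<open>
  Right multiplication by \<open>g\<close> is a nonzero element of \<open>C(p)\<close>, and right multiplication by \<open>h\<close>
  its inverse.
\<close>

lemma idealizer_inverse: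
  fixes p g :: "'a::two_fir"
  assumes p: "p \<in> atoms" and g: "p * g \<in> lideal p" "g \<notin> lideal p"
  obtains h where "p * h \<in> lideal p" "g * h - 1 \<in> lideal p"
proof -
  obtain q h where q: "q \<in> atoms" and ann: "\<And>x. x * g \<in> lideal p \<longleftrightarrow> x \<in> lideal q"
    and h: "h * g - 1 \<in> lideal p"
    using annihilator_atom[OF p g(2) atoms_nonzero[OF p] g(1)] by metis
  \<comment> \<open>Since \<open>p\<close> itself kills \<open>g\<close>, the annihilator
    \<open>Rq\<close> of \<open>g\<close> contains \<open>Rp\<close> and hence equals it: right
    multiplication by \<open>g\<close> is injective on \<open>R/Rp\<close>.\<close>
  have "p \<in> lideal q" using ann g(1) by simp
  then have eq: "lideal q = lideal p" by (rule atom_factor[OF p _ atoms_nonunit[OF q]])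
  have "p * (h * g - 1) + p \<in> lideal p" by (intro lideal_add lideal_mult[OF h] lideal_self)
  then have "(p * h) * g \<in> lideal p" by (simp add: algebra_simps)
  then have "p * h \<in> lideal p" using ann eq by simp
  moreover have "(g * h - 1) * g \<in> lideal p" using lideal_mult[OF h, of g] by (simp add: algebra_simps)
  then have "g * h - 1 \<in> lideal p" using ann eq by simp
  ultimately show thesis by (rule that)
qed

lemma pregeometry_C:
  fixes p :: "'a::two_fir"
  assumes "p \<in> atoms"
  shows "pregeometry (qmod p) (C_span p)"
proof
  fix S :: "'a set set" assume S: "S \<subseteq> qmod p"
  show "C_span p S \<subseteq> qmod p" using S by (rule C_span_subset_qmod)
  show "S \<subseteq> C_span p S" by (rule C_span_superset)
  show "C_span p (C_span p S) \<subseteq> C_span p S" by (rule C_span_minimal[OF order_refl C_span_subspace[OF S]])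
  show "\<exists>T\<subseteq>S. finite T \<and> A \<in> C_span p T" if "A \<in> C_span p S" for A
    using that by (rule C_span_finitary[OF S])
  show "B \<in> C_span p (insert A S)"
    if AB: "A \<in> qmod p" "B \<in> qmod p" and A: "A \<in> C_span p (insert B S)" "A \<notin> C_span p S" for A B
  proof -
    obtain z where z: "A = qcoset p z" using AB(1) by (rule qmodE)
    obtain y where y: "B = qcoset p y" using AB(2) by (rule qmodE)
    have zS: "insert (qcoset p z) S \<subseteq> qmod p" using S by simp
    obtain g where g: "p * g \<in> lideal p" "qcoset p (z - y * g) \<in> C_span p S"
      using C_span_insert[OF S] A(1) unfolding z y by blast
    have "g \<notin> lideal p"
    proof
      assume "g \<in> lideal p"
      then have "qcoset p (z - y * g) = qcoset p z"
        using lideal_diff[OF lideal_0 lideal_mult[of g p y]] by (simp add: qcoset_eq_iff)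
      then show False using g(2) A(2) z by simp
    qed
    then obtain h where h: "p * h \<in> lideal p" "g * h - 1 \<in> lideal p"
      using idealizer_inverse[OF assms g(1)] by metis
    have "qcoset p (z - y * g) \<in> C_span p (insert (qcoset p z) S)"
      using g(2) C_span_mono[of S "insert (qcoset p z) S" p] by blast
    moreover have "qcoset p z \<in> C_span p (insert (qcoset p z) S)"
      using C_span_superset[of "insert (qcoset p z) S" p] by blast
    \<comment> \<open>The difference is \<open>y * g\<close>, and the inverse scalar
      \<open>h\<close> of \<open>g\<close> recovers \<open>y\<close> modulo
      \<open>Rp\<close>.\<close>
    ultimately have "qcoset p ((z - (z - y * g)) * h) \<in> C_span p (insert (qcoset p z) S)"
      using C_span_mult[OF zS C_span_diff[OF zS] h(1)] by blast
    moreover have "qcoset p ((z - (z - y * g)) * h) = qcoset p y"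
      using lideal_mult[OF h(2), of y] by (simp add: qcoset_eq_iff algebra_simps)
    ultimately show ?thesis using z y by simp
  qed
next
  fix S T :: "'a set set" assume "S \<subseteq> T"
  then show "C_span p S \<subseteq> C_span p T" by (rule C_span_mono)
qed

text \<open>Elements of \<open>Y\<close> in \<open>Rp\<close> impose no condition, and each of the
  others has an annihilator generated by an atom; \<open>f\<close> is a common multiple of these
  atoms.\<close>

lemma annihilator_principal:
  fixes p :: "'a::two_fir"
  assumes p: "p \<in> atoms" and Y: "finite Y" and f: "f \<noteq> 0" "\<And>y. y \<in> Y \<Longrightarrow> f * y \<in> lideal p"
  shows "\<exists>m. \<forall>r. (\<forall>y\<in>Y. r * y \<in> lideal p) \<longleftrightarrow> r \<in> lideal m"
proof -
  let ?Z = "{y \<in> Y. y \<notin> lideal p}"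
  have "\<forall>y\<in>?Z. \<exists>q. \<forall>r. r * y \<in> lideal p \<longleftrightarrow> r \<in> lideal q"
  proof
    fix y assume y: "y \<in> ?Z"
    then obtain q h where "\<And>r. r * y \<in> lideal p \<longleftrightarrow> r \<in> lideal q"
      using annihilator_atom[OF p _ f(1)] f(2) by (metis (lifting) mem_Collect_eq)
    then show "\<exists>q. \<forall>r. r * y \<in> lideal p \<longleftrightarrow> r \<in> lideal q" by blast
  qed
  then obtain q where q: "\<forall>y\<in>?Z. \<forall>r. r * y \<in> lideal p \<longleftrightarrow> r \<in> lideal (q y)" by metis
  have "\<exists>m. (\<Inter>\<gamma>\<in>q ` ?Z. lideal \<gamma>) = lideal m"
    using Y f q by (intro INT_lideal_principal[of _ f]) auto
  then obtain m where m: "(\<Inter>\<gamma>\<in>q ` ?Z. lideal \<gamma>) = lideal m" by auto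
  have "(\<forall>y\<in>Y. r * y \<in> lideal p) \<longleftrightarrow> r \<in> lideal m" for r
  proof -
    have "(\<forall>y\<in>Y. r * y \<in> lideal p) \<longleftrightarrow> (\<forall>y\<in>?Z. r * y \<in> lideal p)"
      using lideal_mult by blast
    also have "\<dots> \<longleftrightarrow> r \<in> (\<Inter>\<gamma>\<in>q ` ?Z. lideal \<gamma>)" using q by simp
    finally show ?thesis unfolding m .
  qed
  then show ?thesis by blast
qed

text \<open>
  A density statement. Although \<open>R/Rp\<close> need not be simple, a generator \<open>m\<close> of the annihilator of
  \<open>Y\<close> with \<open>my \<noteq> 0\<close> in \<open>R/Rp\<close> generates \<open>R/Rp\<close> as soon as a nonzero multiple of \<open>m\<close> kills \<open>y\<close>;
  hence \<open>my \<mapsto> mz\<close> extends to an element of \<open>C(p)\<close>, which removes \<open>y\<close> from the list.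
\<close>

lemma density:
  fixes p :: "'a::two_fir"
  assumes p: "p \<in> atoms" and f0: "f \<noteq> 0" and Y: "finite Y"
  shows "(\<And>y. y \<in> Y \<Longrightarrow> f * y \<in> lideal p) \<Longrightarrow>
    (\<And>r. (\<forall>y\<in>Y. r * y \<in> lideal p) \<Longrightarrow> r * z \<in> lideal p) \<Longrightarrow>
    qcoset p z \<in> C_span p (qcoset p ` Y)"
  using Y
proof (induction Y arbitrary: z rule: finite_induct)
  case empty
  have "1 * z \<in> lideal p" using empty(2)[of 1] by simp
  then have "qcoset p z = qcoset p 0" by (simp add: qcoset_eq_iff)
  then show ?case using C_span_zero[of "{}" p] by simp
next
  case (insert y Y)
  have fY: "\<And>y. y \<in> Y \<Longrightarrow> f * y \<in> lideal p" using insert.prems(1) by simp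
  obtain m where m: "\<And>r. (\<forall>y\<in>Y. r * y \<in> lideal p) \<longleftrightarrow> r \<in> lideal m"
    using annihilator_principal[OF p insert.hyps(1) f0 fY] by auto
  have sub: "qcoset p ` insert y Y \<subseteq> qmod p" by auto
  have mono: "C_span p (qcoset p ` Y) \<subseteq> C_span p (qcoset p ` insert y Y)"
    by (intro C_span_mono) auto
  show ?case
  proof (cases "m * y \<in> lideal p")
    case True
    have "r * z \<in> lideal p" if "\<forall>y\<in>Y. r * y \<in> lideal p" for r
    proof -
      have "r \<in> lideal m" using that m by blast
      then obtain s where "r = s * m" by (auto simp: lideal_iff)
      then have "r * y \<in> lideal p" using lideal_mult[OF True, of s] by (simp add: mult.assoc)
      then show ?thesis using that insert.prems(2)[of r] by simp
    qed
    then have "qcoset p z \<in> C_span p (qcoset p ` Y)" using insert.IH fY by blast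
    then show ?thesis using mono by blast
  next
    case False
    have "f \<in> lideal m" using m fY by blast
    then obtain t where t: "f = t * m" by (auto simp: lideal_iff)
    have "t \<noteq> 0" using t f0 by auto
    moreover have "t * (m * y) \<in> lideal p" using insert.prems(1)[of y] t by (simp add: mult.assoc)
    ultimately obtain h where h: "h * (m * y) - 1 \<in> lideal p"
      using annihilator_atom[OF p False] by metis
    have kill: "(s * m) * z \<in> lideal p" if "(s * m) * y \<in> lideal p" for s
      using insert.prems(2)[of "s * m"] that m[of "s * m"] by simp
    \<comment> \<open>By \<open>kill\<close>, whatever annihilates \<open>m * y\<close> annihilates
      \<open>m * z\<close>, so there is an endomorphism taking \<open>m * y\<close> to
      \<open>m * z\<close>. As \<open>1\<close> is congruent to \<open>h * (m * y)\<close>, its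
      image is \<open>c\<close>.\<close>
    define c where "c = h * m * z"
    have "p * (h * (m * y) - 1) + p \<in> lideal p" by (intro lideal_add lideal_mult[OF h] lideal_self)
    then have "((p * h) * m) * y \<in> lideal p" by (simp add: algebra_simps)
    then have pc: "p * c \<in> lideal p" using kill[of "p * h"] by (simp add: c_def mult.assoc)
    \<comment> \<open>\<open>1 - m * y * h\<close> annihilates \<open>m * y\<close>, hence also
      \<open>m * z\<close>. This says that \<open>m\<close> annihilates \<open>z - y * c\<close>, so
      the induction hypothesis applies to that vector.\<close>
    have "m * y - m * y * (h * (m * y)) = - (m * y) * (h * (m * y) - 1)"
      by (simp add: algebra_simps)
    also have "\<dots> \<in> lideal p" using h by (rule lideal_mult)
    finally have "((1 - m * y * h) * m) * y \<in> lideal p" by (simp add: algebra_simps)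
    then have mc: "((1 - m * y * h) * m) * z \<in> lideal p" by (rule kill)
    have "r * (z - y * c) \<in> lideal p" if "\<forall>y\<in>Y. r * y \<in> lideal p" for r
    proof -
      have "r \<in> lideal m" using that m by blast
      then obtain s where s: "r = s * m" by (auto simp: lideal_iff)
      have "r * (z - y * c) = s * (((1 - m * y * h) * m) * z)"
        by (simp add: s c_def algebra_simps)
      then show ?thesis using lideal_mult[OF mc] by simp
    qed
    then have "qcoset p (z - y * c) \<in> C_span p (qcoset p ` Y)" using insert.IH fY by blast
    then have 1: "qcoset p (z - y * c) \<in> C_span p (qcoset p ` insert y Y)" using mono by blast
    have "qcoset p y \<in> C_span p (qcoset p ` insert y Y)"
      using C_span_superset[of "qcoset p ` insert y Y" p] by blast
    then have "qcoset p (y * c) \<in> C_span p (qcoset p ` insert y Y)" using C_span_mult[OF sub] pc by blast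
    then have "qcoset p ((z - y * c) + y * c) \<in> C_span p (qcoset p ` insert y Y)"
      using C_span_add[OF sub 1] by blast
    then show ?thesis by simp
  qed
qed

text \<open>Left multiplication by \<open>r\<close> commutes with the scalars, so its kernel is a
  subspace.\<close>

lemma C_subspace_annihilated: "C_subspace p (qcoset p ` {z. r * z \<in> lideal p})"
proof -
  have mem: "qcoset p x \<in> qcoset p ` {z. r * z \<in> lideal p} \<longleftrightarrow> r * x \<in> lideal p" for x
  proof
    assume "qcoset p x \<in> qcoset p ` {z. r * z \<in> lideal p}"
    then obtain z where z: "r * z \<in> lideal p" "x - z \<in> lideal p" by (auto simp: qcoset_eq_iff)
    have "r * (x - z) + r * z \<in> lideal p" using lideal_add[OF lideal_mult[OF z(2)] z(1)] .
    then show "r * x \<in> lideal p" by (simp add: algebra_simps)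
  qed simp
  show ?thesis
    unfolding C_subspace_iff mem
    using lideal_add lideal_mult_right by (auto simp: distrib_left simp flip: mult.assoc)
qed

text \<open>The elementary converse of \<open>density\<close>: the vectors killed by
  \<open>r\<close> form a subspace, which contains the span as soon as it contains
  \<open>Y\<close>.\<close>

lemma C_span_annihilated:
  assumes "\<And>y. y \<in> Y \<Longrightarrow> r * y \<in> lideal p" "qcoset p z \<in> C_span p (qcoset p ` Y)"
  shows "r * z \<in> lideal p"
proof -
  have "qcoset p ` Y \<subseteq> qcoset p ` {z. r * z \<in> lideal p}" using assms(1) by auto
  from C_span_minimal[OF this C_subspace_annihilated]
  obtain z' where z': "qcoset p z = qcoset p z'" "r * z' \<in> lideal p" using assms(2) by blast
  then have "z - z' \<in> lideal p" by (simp add: qcoset_eq_iff)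
  then have "r * (z - z') + r * z' \<in> lideal p" using z'(2) by (intro lideal_add lideal_mult[of "z - z'"])
  then show ?thesis by (simp add: algebra_simps)
qed

lemma C_dim_eq_ecard:
  fixes p :: "'a::two_fir"
  assumes "p \<in> atoms" "W \<subseteq> qmod p" "C_basis p W B"
  shows "C_dim p W = ecard B"
proof -
  interpret pregeometry "qmod p" "C_span p" using assms(1) by (rule pregeometry_C)
  have b: "basis W C" if "C_basis p W C" for C
    using that assms(2) by (auto simp: C_basis_def basis_def C_independent_def indep_def)
  have "C_basis p W (SOME B. C_basis p W B)" using assms(3) by (rule someI)
  then show ?thesis unfolding C_dim_def using b assms(3) basis_ecard_unique by blast
qed


section \<open>Rank\<close>

lemma F_independent_iff:
  fixes \<Delta> :: "'a::two_fir set"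
  assumes "F_algebraic \<Delta>" "\<Delta> \<subseteq> atoms" "I \<subseteq> \<Delta>"
  shows "F_independent I \<longleftrightarrow> pregeometry.indep \<Delta> (\<lambda>B. {\<delta> \<in> \<Delta>. F_dependent \<delta> B}) I"
proof -
  interpret pregeometry \<Delta> "\<lambda>B. {\<delta> \<in> \<Delta>. F_dependent \<delta> B}" using assms by (intro pregeometry_F)
  have "F_algebraic I" using F_algebraic_subset assms by blast
  then show ?thesis using assms(3) unfolding F_independent_def indep_def by auto
qed

lemma F_basis_iff:
  fixes \<Delta> :: "'a::two_fir set"
  assumes "F_algebraic \<Delta>" "\<Delta> \<subseteq> atoms" "S \<subseteq> \<Delta>"
  shows "F_basis S B \<longleftrightarrow> pregeometry.basis \<Delta> (\<lambda>B. {\<delta> \<in> \<Delta>. F_dependent \<delta> B}) S B"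
proof -
  interpret pregeometry \<Delta> "\<lambda>B. {\<delta> \<in> \<Delta>. F_dependent \<delta> B}" using assms by (intro pregeometry_F)
  show ?thesis
    unfolding F_basis_def basis_def using F_independent_iff[OF assms(1,2), of B] assms(3) by auto
qed

lemma F_basis_exists:
  fixes \<Delta> :: "'a::two_fir set"
  assumes "F_algebraic \<Delta>" "\<Delta> \<subseteq> atoms"
  obtains B where "F_basis \<Delta> B"
proof -
  interpret pregeometry \<Delta> "\<lambda>B. {\<delta> \<in> \<Delta>. F_dependent \<delta> B}" using assms by (intro pregeometry_F)
  obtain B where "basis \<Delta> B" using basis_exists[OF order_refl] by auto
  then show thesis using that F_basis_iff[OF assms order_refl] by simp
qed

lemma F_rank_eq_ecard:
  fixes \<Delta> :: "'a::two_fir set"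
  assumes "F_algebraic \<Delta>" "\<Delta> \<subseteq> atoms" "F_basis \<Delta> B"
  shows "F_rank \<Delta> = ecard B"
proof -
  interpret pregeometry \<Delta> "\<lambda>B. {\<delta> \<in> \<Delta>. F_dependent \<delta> B}" using assms by (intro pregeometry_F)
  have "F_basis \<Delta> (SOME B. F_basis \<Delta> B)" using assms(3) by (rule someI)
  then have "basis \<Delta> (SOME B. F_basis \<Delta> B)" by (rule iffD1[OF F_basis_iff[OF assms(1,2) order_refl]])
  moreover have "basis \<Delta> B" using assms(3) by (rule iffD1[OF F_basis_iff[OF assms(1,2) order_refl]])
  ultimately show ?thesis unfolding F_rank_def by (rule basis_ecard_unique)
qed

lemma ecard_F_independent_le:
  fixes \<Delta> :: "'a::two_fir set"
  assumes "F_algebraic \<Delta>" "\<Delta> \<subseteq> atoms" "I \<subseteq> \<Delta>" "F_independent I"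
  shows "ecard I \<le> F_rank \<Delta>"
proof -
  interpret pregeometry \<Delta> "\<lambda>B. {\<delta> \<in> \<Delta>. F_dependent \<delta> B}" using assms by (intro pregeometry_F)
  obtain B where B: "F_basis \<Delta> B" using F_basis_exists assms by blast
  then have "indep I" "B \<subseteq> \<Delta>" "\<Delta> \<subseteq> {\<delta> \<in> \<Delta>. F_dependent \<delta> B}"
    using assms F_independent_iff by (auto simp: F_basis_def)
  then have "ecard I \<le> ecard B" using ecard_indep_le[of B I] assms(3) by blast
  then show ?thesis using F_rank_eq_ecard[OF assms(1,2) B] by simp
qed

lemma F_rank_mono:
  fixes \<Delta> :: "'a::two_fir set"
  assumes "F_algebraic \<Delta>" "\<Delta> \<subseteq> atoms" "S \<subseteq> \<Delta>"
  shows "F_rank S \<le> F_rank \<Delta>"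
proof -
  have S: "F_algebraic S" "S \<subseteq> atoms" using F_algebraic_subset assms by blast+
  then obtain B where B: "F_basis S B" by (rule F_basis_exists)
  then show ?thesis
    using ecard_F_independent_le[OF assms(1,2), of B] assms(3) F_rank_eq_ecard[OF S B]
    by (auto simp: F_basis_def)
qed

lemma F_rank_finite:
  fixes \<Delta> :: "'a::two_fir set"
  assumes "F_algebraic \<Delta>" "\<Delta> \<subseteq> atoms" "finite \<Delta>"
  shows "F_rank \<Delta> \<noteq> \<infinity>"
proof -
  obtain B where B: "F_basis \<Delta> B" using F_basis_exists assms by blast
  then have "finite B" using assms(3) finite_subset by (auto simp: F_basis_def)
  then show ?thesis using F_rank_eq_ecard[OF assms(1,2) B] by (simp add: ecard_def)
qed

lemma F_dependent_mono:
  fixes \<Delta> :: "'a::two_fir set"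
  assumes "F_algebraic \<Delta>" "\<Delta> \<subseteq> atoms" "S \<subseteq> T" "T \<subseteq> \<Delta>" "\<delta> \<in> \<Delta>" "F_dependent \<delta> S"
  shows "F_dependent \<delta> T"
  using pregeometry.cl_mono[OF pregeometry_F[OF assms(1,2)] assms(3,4)] assms(5,6) by blast

lemma F_dependent_Int_sim_class:
  fixes \<Delta> :: "'a::two_fir set"
  assumes "F_algebraic \<Delta>" "\<Delta> \<subseteq> atoms" "B \<subseteq> \<Delta>" "\<delta> \<in> \<Delta>" "F_dependent \<delta> B"
  shows "F_dependent \<delta> (B \<inter> sim_class \<delta>)"
proof -
  have "\<delta> \<in> atoms" "B \<subseteq> atoms" using assms by auto
  then have "\<exists>\<Gamma>\<subseteq>B \<inter> sim_class \<delta>. finite \<Gamma> \<and> \<Gamma> \<noteq> {} \<and> (\<Inter>\<gamma>\<in>\<Gamma>. lideal \<gamma>) \<subseteq> lideal \<delta>"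
    by (rule F_dependent_similar[OF assms(5)])
  then have "\<exists>\<Gamma>\<subseteq>B \<inter> sim_class \<delta>. finite \<Gamma> \<and> (\<Inter>\<gamma>\<in>\<Gamma>. lideal \<gamma>) \<subseteq> lideal \<delta>" by metis
  then show ?thesis
    by (rule iffD2[OF F_dependent_iff_within[OF assms(1,2) _ assms(4)], rotated]) (use assms in blast)
qed

lemma not_F_dependent_empty:
  fixes \<delta> :: "'a::two_fir"
  assumes "\<delta> \<in> atoms"
  shows "\<not> F_dependent \<delta> {}"
  using F_dependent_similar[of \<delta> "{}"] assms by auto

text \<open>With \<open>g \<gamma>\<close> representing the vector of \<open>\<gamma>\<close>, the
  inclusion of ideals reads: every \<open>r\<close> killing all \<open>g \<gamma>\<close> kills
  \<open>g \<delta>\<close>. One direction is \<open>density\<close>, applicable thanks to the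
  common multiple \<open>f\<close>; the other is \<open>C_span_annihilated\<close> after passing to
  finitely many generators.\<close>

lemma F_dependent_iff_C_span:
  fixes p :: "'a::two_fir"
  assumes p: "p \<in> atoms" and \<Delta>: "F_algebraic \<Delta>" "\<Delta> \<subseteq> atoms"
    and \<psi>: "\<And>\<gamma>. \<gamma> \<in> \<Delta> \<Longrightarrow> \<psi> \<gamma> \<in> qiso \<gamma> p" and B: "B \<subseteq> \<Delta>" "\<delta> \<in> \<Delta>"
  shows "F_dependent \<delta> B \<longleftrightarrow>
    \<psi> \<delta> (qcoset \<delta> 1) \<in> C_span p ((\<lambda>\<gamma>. \<psi> \<gamma> (qcoset \<gamma> 1)) ` B)"
proof -
  have "\<forall>\<gamma>\<in>\<Delta>. \<exists>g. \<psi> \<gamma> (qcoset \<gamma> 1) = qcoset p g"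
  proof
    fix \<gamma> assume "\<gamma> \<in> \<Delta>"
    then have "\<psi> \<gamma> (qcoset \<gamma> 1) \<in> qmod p" using \<psi>[of \<gamma>] by (auto simp: qiso_def qhom_def)
    then show "\<exists>g. \<psi> \<gamma> (qcoset \<gamma> 1) = qcoset p g" by (metis qmodE)
  qed
  then obtain g where g: "\<forall>\<gamma>\<in>\<Delta>. \<psi> \<gamma> (qcoset \<gamma> 1) = qcoset p (g \<gamma>)" by metis
  have ann: "x * g \<gamma> \<in> lideal p \<longleftrightarrow> x \<in> lideal \<gamma>" if "\<gamma> \<in> \<Delta>" for x \<gamma>
    using qiso_rep(1)[OF \<psi>[OF that] g[rule_format, OF that]] .
  have img: "(\<lambda>\<gamma>. \<psi> \<gamma> (qcoset \<gamma> 1)) ` S = qcoset p ` g ` S" if "S \<subseteq> \<Delta>" for S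
    unfolding image_image using g that by (intro image_cong) auto
  note dep = F_dependent_iff_within[OF \<Delta> B]
  show ?thesis
    unfolding img[OF B(1)] g[rule_format, OF B(2)]
  proof
    assume "F_dependent \<delta> B"
    from iffD1[OF dep this] obtain \<Gamma> where
      \<Gamma>: "\<Gamma> \<subseteq> B" "finite \<Gamma>" "(\<Inter>\<gamma>\<in>\<Gamma>. lideal \<gamma>) \<subseteq> lideal \<delta>"
      by (elim exE conjE)
    obtain f where f: "f \<noteq> 0" "\<forall>\<gamma>\<in>\<Delta>. f \<in> lideal \<gamma>" using \<Delta> F_algebraic_iff[of \<Delta>] by auto
    have "qcoset p (g \<delta>) \<in> C_span p (qcoset p ` g ` \<Gamma>)"
    proof (rule density[OF p f(1)])
      show "finite (g ` \<Gamma>)" using \<Gamma> by simp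
      show "f * y \<in> lideal p" if "y \<in> g ` \<Gamma>" for y using that ann f(2) \<Gamma>(1) B by blast
      show "r * g \<delta> \<in> lideal p" if r: "\<forall>y\<in>g ` \<Gamma>. r * y \<in> lideal p" for r
      proof -
        have "r \<in> lideal \<gamma>" if "\<gamma> \<in> \<Gamma>" for \<gamma>
        proof -
          have "r * g \<gamma> \<in> lideal p" using r that by simp
          then show ?thesis using ann that \<Gamma>(1) B(1) by blast
        qed
        then have "r \<in> lideal \<delta>" using \<Gamma>(3) by blast
        then show ?thesis using ann B(2) by blast
      qed
    qed
    moreover have "C_span p (qcoset p ` g ` \<Gamma>) \<subseteq> C_span p (qcoset p ` g ` B)"
      using \<Gamma>(1) by (intro C_span_mono image_mono)
    ultimately show "qcoset p (g \<delta>) \<in> C_span p (qcoset p ` g ` B)" by blast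
  next
    assume "qcoset p (g \<delta>) \<in> C_span p (qcoset p ` g ` B)"
    moreover have "qcoset p ` g ` B \<subseteq> qmod p" by auto
    ultimately obtain T where T: "T \<subseteq> qcoset p ` g ` B" "finite T" "qcoset p (g \<delta>) \<in> C_span p T"
      using C_span_finitary by metis
    then obtain \<Gamma> where \<Gamma>: "\<Gamma> \<subseteq> B" "finite \<Gamma>" "T = qcoset p ` g ` \<Gamma>"
      using finite_subset_image[of T "\<lambda>x. qcoset p (g x)" B] by (auto simp: image_image)
    have "(\<Inter>\<gamma>\<in>\<Gamma>. lideal \<gamma>) \<subseteq> lideal \<delta>"
    proof
      fix r assume r: "r \<in> (\<Inter>\<gamma>\<in>\<Gamma>. lideal \<gamma>)"
      have "r * g \<delta> \<in> lideal p"
      proof (rule C_span_annihilated)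
        show "qcoset p (g \<delta>) \<in> C_span p (qcoset p ` g ` \<Gamma>)" using T \<Gamma> by simp
        show "r * y \<in> lideal p" if "y \<in> g ` \<Gamma>" for y using that ann r \<Gamma>(1) B(1) by blast
      qed
      then show "r \<in> lideal \<delta>" using ann B(2) by blast
    qed
    then have "\<exists>\<Gamma>\<subseteq>B. finite \<Gamma> \<and> (\<Inter>\<gamma>\<in>\<Gamma>. lideal \<gamma>) \<subseteq> lideal \<delta>"
      using \<Gamma> by (intro exI[of _ \<Gamma>] conjI)
    then show "F_dependent \<delta> B" by (rule iffD2[OF dep])
  qed
qed

text \<open>The vectors of an F-basis form a \<open>C(p)\<close>-basis. They are pairwise distinct,
  because two basis atoms with the same vector would depend on each other. In particular the
  dimension does not depend on the chosen isomorphisms.\<close>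

lemma C_dim_eq_F_rank:
  fixes p :: "'a::two_fir"
  assumes p: "p \<in> atoms" and \<Delta>: "F_algebraic \<Delta>" "\<Delta> \<subseteq> atoms"
    and \<psi>: "\<And>\<gamma>. \<gamma> \<in> \<Delta> \<Longrightarrow> \<psi> \<gamma> \<in> qiso \<gamma> p"
  shows "C_dim p (C_span p ((\<lambda>\<gamma>. \<psi> \<gamma> (qcoset \<gamma> 1)) ` \<Delta>)) = F_rank \<Delta>"
proof -
  define y where "y = (\<lambda>\<gamma>. \<psi> \<gamma> (qcoset \<gamma> 1))"
  have y_mod: "y \<gamma> \<in> qmod p" if "\<gamma> \<in> \<Delta>" for \<gamma>
    using \<psi>[OF that] by (auto simp: y_def qiso_def qhom_def)
  have dep: "F_dependent \<delta> B \<longleftrightarrow> y \<delta> \<in> C_span p (y ` B)" if "B \<subseteq> \<Delta>" "\<delta> \<in> \<Delta>" for B \<delta>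
    using F_dependent_iff_C_span[OF p \<Delta> \<psi> that] by (simp add: y_def)
  obtain B where B: "F_basis \<Delta> B" using F_basis_exists[OF \<Delta>] by blast
  then have B\<Delta>: "B \<subseteq> \<Delta>" by (simp add: F_basis_def)
  have ind: "y \<delta> \<notin> C_span p (y ` (B - {\<delta>}))" if "\<delta> \<in> B" for \<delta>
  proof -
    have "\<not> F_dependent \<delta> (B - {\<delta>})" using B that by (simp add: F_basis_def F_independent_def)
    moreover have "B - {\<delta>} \<subseteq> \<Delta>" "\<delta> \<in> \<Delta>" using B\<Delta> that by auto
    ultimately show ?thesis using dep by blast
  qed
  have inj: "inj_on y B"
  proof (rule inj_onI, rule ccontr)
    fix \<gamma> \<delta> assume *: "\<gamma> \<in> B" "\<delta> \<in> B" "y \<gamma> = y \<delta>" "\<gamma> \<noteq> \<delta>"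
    then have "y \<delta> \<in> y ` (B - {\<delta>})" by (metis Diff_iff empty_iff image_eqI insert_iff)
    then show False using ind[OF *(2)] C_span_superset[of "y ` (B - {\<delta>})" p] by blast
  qed
  have sub: "y ` \<Delta> \<subseteq> qmod p" "y ` B \<subseteq> qmod p" using y_mod B\<Delta> by auto
  have "C_span p (y ` B) = C_span p (y ` \<Delta>)"
  proof (rule C_span_eqI)
    show "y ` B \<subseteq> C_span p (y ` \<Delta>)" using B\<Delta> C_span_superset[of "y ` \<Delta>" p] by blast
    show "y ` \<Delta> \<subseteq> C_span p (y ` B)" using B dep[OF B\<Delta>] by (auto simp: F_basis_def)
  qed (use sub in blast)+
  moreover have "C_independent p (y ` B)"
    unfolding C_independent_def
  proof
    fix v assume "v \<in> y ` B"
    then obtain \<delta> where \<delta>: "\<delta> \<in> B" "v = y \<delta>" by blast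
    have "y ` B - {v} = y ` (B - {\<delta>})" using inj \<delta> by (auto simp: inj_on_def)
    then show "v \<notin> C_span p (y ` B - {v})" using ind \<delta> by simp
  qed
  ultimately have "C_basis p (C_span p (y ` \<Delta>)) (y ` B)"
    using C_span_superset[of "y ` B" p] by (simp add: C_basis_def)
  then have "C_dim p (C_span p (y ` \<Delta>)) = ecard (y ` B)"
    by (rule C_dim_eq_ecard[OF p C_span_subset_qmod[OF sub(1)]])
  also have "\<dots> = ecard B" using inj by (simp add: ecard_def card_image finite_image_iff)
  finally show ?thesis using F_rank_eq_ecard[OF \<Delta> B] by (simp add: y_def)
qed

section \<open>Additivity of the rank over similarity classes\<close>

lemma sum_enat_ne_infinity:
  "(\<And>i. i < n \<Longrightarrow> A i \<noteq> \<infinity>) \<Longrightarrow> (\<Sum>i<n. A i) \<noteq> (\<infinity>::enat)" for n :: nat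
  by (induction n) (auto simp: plus_eq_infty_iff_enat)

lemma ecard_Un_disjoint: "A \<inter> B = {} \<Longrightarrow> ecard (A \<union> B) = ecard A + ecard B"
  by (auto simp: ecard_def card_Un_disjoint)

lemma ecard_UN_disjoint:
  "(\<And>i j. i < n \<Longrightarrow> j < n \<Longrightarrow> i \<noteq> j \<Longrightarrow> A i \<inter> A j = {}) \<Longrightarrow>
    ecard (\<Union>i<n. A i) = (\<Sum>i<n. ecard (A i))" for n :: nat
proof (induction n)
  case 0
  show ?case by (simp add: ecard_def zero_enat_def)
next
  case (Suc n)
  have "A i \<inter> A n = {}" if "i < n" for i using Suc.prems[of i n] that by simp
  then have "(\<Union>i<n. A i) \<inter> A n = {}" by auto
  then have "ecard (\<Union>i<Suc n. A i) = ecard (\<Union>i<n. A i) + ecard (A n)"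
    by (simp add: lessThan_Suc Un_commute flip: ecard_Un_disjoint)
  then show ?case using Suc by simp
qed

lemma nonsimilar_atoms_unique:
  assumes "nonsimilar_atoms n p" "i < n" "j < n" "\<gamma> \<in> sim_class (p i)" "\<delta> \<in> sim_class (p j)"
    "similar_elts \<gamma> \<delta>"
  shows "i = j"
proof -
  have "similar_elts (p i) \<delta>" using assms similar_elts_trans by (auto simp: sim_class_iff)
  then have "similar_elts (p i) (p j)"
    using assms(5) similar_elts_trans similar_elts_sym by (metis sim_class_iff)
  then show ?thesis using assms unfolding nonsimilar_atoms_def by blast
qed

text \<open>Bases of the single classes unite to a basis, since a dependence involves only atoms
  similar to the dependent one. A covering is assumed rather than \<open>class_reps\<close>: classes
  that \<open>\<Delta>\<close> misses are allowed and contribute 0.\<close>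

lemma F_rank_sum:
  fixes \<Delta> :: "'a::two_fir set"
  assumes \<Delta>: "F_algebraic \<Delta>" "\<Delta> \<subseteq> atoms" and p: "nonsimilar_atoms n p"
    and cover: "\<Delta> = (\<Union>i<n. \<Delta> \<inter> sim_class (p i))"
  shows "F_rank \<Delta> = (\<Sum>i<n. F_rank (\<Delta> \<inter> sim_class (p i)))"
proof -
  let ?D = "\<lambda>i. \<Delta> \<inter> sim_class (p i)"
  have D: "F_algebraic (?D i)" "?D i \<subseteq> atoms" for i using \<Delta> F_algebraic_subset by blast+
  have "\<exists>B. F_basis (?D i) B" for i using F_basis_exists[OF D] by metis
  then obtain B where B: "\<And>i. F_basis (?D i) (B i)" by metis
  have BD: "B i \<subseteq> ?D i" for i using B by (simp add: F_basis_def)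
  let ?B = "\<Union>i<n. B i"
  have B\<Delta>: "?B \<subseteq> \<Delta>" using BD by blast
  have "\<not> F_dependent \<delta> (?B - {\<delta>})" if in_B: "\<delta> \<in> ?B" for \<delta>
  proof
    assume dep: "F_dependent \<delta> (?B - {\<delta>})"
    obtain i where i: "i < n" "\<delta> \<in> B i" using in_B by blast
    have \<delta>: "\<delta> \<in> \<Delta>" using i BD by blast
    have "F_dependent \<delta> ((?B - {\<delta>}) \<inter> sim_class \<delta>)"
      using B\<Delta> \<delta> dep by (intro F_dependent_Int_sim_class[OF \<Delta>]) auto
    moreover have "(?B - {\<delta>}) \<inter> sim_class \<delta> \<subseteq> B i - {\<delta>}"
    proof
      fix \<gamma> assume \<gamma>: "\<gamma> \<in> (?B - {\<delta>}) \<inter> sim_class \<delta>"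
      then obtain j where j: "j < n" "\<gamma> \<in> B j" by blast
      have "\<delta> \<in> sim_class (p i)" "\<gamma> \<in> sim_class (p j)" using BD i j by blast+
      moreover have "similar_elts \<delta> \<gamma>" using \<gamma> by (simp add: sim_class_iff)
      ultimately have "i = j" by (rule nonsimilar_atoms_unique[OF p i(1) j(1)])
      then show "\<gamma> \<in> B i - {\<delta>}" using \<gamma> j by blast
    qed
    moreover have "B i - {\<delta>} \<subseteq> \<Delta>" using BD by blast
    ultimately have "F_dependent \<delta> (B i - {\<delta>})" using F_dependent_mono[OF \<Delta>] \<delta> by metis
    then show False using B i by (auto simp: F_basis_def F_independent_def)
  qed
  moreover have "F_algebraic ?B" using F_algebraic_subset[OF \<Delta> B\<Delta>] .
  moreover have "F_dependent \<delta> ?B" if \<delta>: "\<delta> \<in> \<Delta>" for \<delta>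
  proof -
    obtain i where i: "i < n" "\<delta> \<in> ?D i" using cover \<delta> by blast
    then have "F_dependent \<delta> (B i)" using B by (simp add: F_basis_def)
    moreover have "B i \<subseteq> ?B" using i by blast
    ultimately show ?thesis using F_dependent_mono[OF \<Delta> _ B\<Delta> \<delta>] by metis
  qed
  ultimately have "F_basis \<Delta> ?B" using B\<Delta> by (simp add: F_basis_def F_independent_def)
  then have "F_rank \<Delta> = ecard ?B" by (rule F_rank_eq_ecard[OF \<Delta>])
  also have "\<dots> = (\<Sum>i<n. ecard (B i))"
  proof (rule ecard_UN_disjoint)
    fix i j assume ij: "i < n" "j < n" "i \<noteq> j"
    show "B i \<inter> B j = {}"
    proof (rule ccontr)
      assume "B i \<inter> B j \<noteq> {}"
      then obtain \<gamma> where \<gamma>: "\<gamma> \<in> B i" "\<gamma> \<in> B j" by blast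
      then have "\<gamma> \<noteq> 0" using BD D atoms_nonzero by blast
      then have "i = j"
        by (intro nonsimilar_atoms_unique[OF p ij(1,2), of \<gamma> \<gamma>])
          (use BD \<gamma> in \<open>auto intro: similar_elts_refl\<close>)
      then show False using ij by simp
    qed
  qed
  finally show ?thesis using F_rank_eq_ecard[OF D B] by simp
qed

text \<open>A witness for \<open>\<delta>\<close> consists of atoms similar to
  \<open>\<delta>\<close>, so it stays within one class. Monotonicity inside \<open>\<Delta>\<close>
  is no help for the converse, as \<open>\<delta>\<close> may lie outside
  \<open>\<Delta>\<close>.\<close>

lemma F_closure_Union:
  fixes \<Delta> :: "'a::two_fir set"
  assumes \<Delta>: "F_algebraic \<Delta>" "\<Delta> \<subseteq> atoms" and p: "class_reps \<Delta> n p"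
  shows "F_closure \<Delta> = (\<Union>i<n. F_closure (\<Delta> \<inter> sim_class (p i)))"
proof (intro equalityI subsetI)
  fix \<delta> assume "\<delta> \<in> F_closure \<Delta>"
  then have \<delta>: "\<delta> \<in> atoms" "F_dependent \<delta> \<Delta>" by (auto simp: F_closure_def)
  obtain \<Gamma> where \<Gamma>: "\<Gamma> \<subseteq> \<Delta> \<inter> sim_class \<delta>" "finite \<Gamma>" "\<Gamma> \<noteq> {}"
    "(\<Inter>\<gamma>\<in>\<Gamma>. lideal \<gamma>) \<subseteq> lideal \<delta>"
    using F_dependent_similar[OF \<delta>(2,1) \<Delta>(2)] by (elim exE conjE)
  then obtain \<gamma>0 where \<gamma>0: "\<gamma>0 \<in> \<Gamma>" by blast
  then obtain i where i: "i < n" "\<gamma>0 \<in> sim_class (p i)"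
    using p \<Gamma>(1) unfolding class_reps_def by blast
  have "\<Gamma> \<subseteq> sim_class (p i)"
  proof
    fix \<gamma> assume "\<gamma> \<in> \<Gamma>"
    then have "similar_elts \<delta> \<gamma>" "similar_elts \<delta> \<gamma>0" "similar_elts (p i) \<gamma>0"
      using \<Gamma>(1) \<gamma>0 i by (auto simp: sim_class_iff)
    then show "\<gamma> \<in> sim_class (p i)"
      unfolding sim_class_iff using similar_elts_trans similar_elts_sym by metis
  qed
  then have \<Gamma>i: "\<Gamma> \<subseteq> \<Delta> \<inter> sim_class (p i)" using \<Gamma>(1) by blast
  have at: "insert \<delta> \<Delta> \<subseteq> atoms" using \<Delta> \<delta> by simp
  have "F_algebraic (insert \<delta> \<Delta>)" using \<delta>(2) by (simp add: F_dependent_def)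
  then have "F_algebraic (insert \<delta> (\<Delta> \<inter> sim_class (p i)))"
    by (rule F_algebraic_subset[OF _ at]) auto
  moreover have "\<exists>\<Gamma>\<subseteq>\<Delta> \<inter> sim_class (p i). finite \<Gamma> \<and> (\<Inter>\<gamma>\<in>\<Gamma>. lideal \<gamma>) \<subseteq> lideal \<delta>"
    using \<Gamma>i \<Gamma>(2,4) by (intro exI[of _ \<Gamma>] conjI)
  moreover have "\<Delta> \<inter> sim_class (p i) \<subseteq> atoms" using \<Delta> by blast
  ultimately have "F_dependent \<delta> (\<Delta> \<inter> sim_class (p i))"
    by (intro iffD2[OF F_dependent_iff[OF \<delta>(1)]] conjI)
  then show "\<delta> \<in> (\<Union>i<n. F_closure (\<Delta> \<inter> sim_class (p i)))"
    using \<delta>(1) i(1) by (auto simp: F_closure_def)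
next
  fix \<delta> assume "\<delta> \<in> (\<Union>i<n. F_closure (\<Delta> \<inter> sim_class (p i)))"
  then obtain i where i: "i < n" and \<delta>: "\<delta> \<in> atoms" and dep: "F_dependent \<delta> (\<Delta> \<inter> sim_class (p i))"
    by (auto simp: F_closure_def)
  have sub: "\<Delta> \<inter> sim_class (p i) \<subseteq> atoms" using \<Delta> by blast
  obtain \<Gamma> where \<Gamma>: "\<Gamma> \<subseteq> \<Delta> \<inter> sim_class (p i)" "finite \<Gamma>" "(\<Inter>\<gamma>\<in>\<Gamma>. lideal \<gamma>) \<subseteq> lideal \<delta>"
    using iffD1[OF F_dependent_iff[OF \<delta> sub] dep] by (elim exE conjE)
  \<comment> \<open>A common multiple \<open>f\<close> of \<open>\<Delta>\<close> lies in the
    intersection over \<open>\<Gamma>\<close> and therefore in \<open>R\<delta>\<close>, so adding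
    \<open>\<delta>\<close> to all of \<open>\<Delta>\<close> keeps it F-algebraic.\<close>
  obtain f where f: "f \<noteq> 0" "\<forall>\<gamma>\<in>\<Delta>. f \<in> lideal \<gamma>" using \<Delta> F_algebraic_iff[of \<Delta>] by auto
  have "f \<in> (\<Inter>\<gamma>\<in>\<Gamma>. lideal \<gamma>)" using f(2) \<Gamma>(1) by blast
  then have "\<forall>\<gamma>\<in>insert \<delta> \<Delta>. f \<in> lideal \<gamma>" using \<Gamma>(3) f(2) by blast
  moreover have "insert \<delta> \<Delta> \<subseteq> atoms" using \<Delta> \<delta> by simp
  ultimately have "F_algebraic (insert \<delta> \<Delta>)" using F_algebraic_iff[of "insert \<delta> \<Delta>"] f(1) by auto
  moreover have "\<exists>\<Gamma>\<subseteq>\<Delta>. finite \<Gamma> \<and> (\<Inter>\<gamma>\<in>\<Gamma>. lideal \<gamma>) \<subseteq> lideal \<delta>"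
    using \<Gamma> by (intro exI[of _ \<Gamma>] conjI) auto
  ultimately have "F_dependent \<delta> \<Delta>" by (intro iffD2[OF F_dependent_iff[OF \<delta> \<Delta>(2)]] conjI)
  then show "\<delta> \<in> F_closure \<Delta>" using \<delta> by (simp add: F_closure_def)
qed

text \<open>The choice \<open>\<rho> \<gamma>\<close> depends only on the class of
  \<open>\<gamma>\<close>, since similar atoms give \<open>SOME\<close> the same predicate. Its
  image is thus a set of pairwise non-similar atoms, finite by assumption.\<close>

lemma class_reps_exists:
  assumes "\<Delta> \<subseteq> atoms" "\<not> infinitely_many_classes \<Delta>"
  shows "\<exists>n p. class_reps \<Delta> n p"
proof -
  define \<rho> where "\<rho> \<gamma> = (SOME \<delta>. \<delta> \<in> \<Delta> \<and> similar_elts \<gamma> \<delta>)" for \<gamma>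
  have \<rho>: "\<rho> \<gamma> \<in> \<Delta>" "similar_elts \<gamma> (\<rho> \<gamma>)" if "\<gamma> \<in> \<Delta>" for \<gamma>
  proof -
    have "\<gamma> \<in> \<Delta> \<and> similar_elts \<gamma> \<gamma>"
      using that assms(1) atoms_nonzero similar_elts_refl by blast
    then have "\<rho> \<gamma> \<in> \<Delta> \<and> similar_elts \<gamma> (\<rho> \<gamma>)" unfolding \<rho>_def by (rule someI)
    then show "\<rho> \<gamma> \<in> \<Delta>" "similar_elts \<gamma> (\<rho> \<gamma>)" by simp_all
  qed
  have \<rho>_eq: "\<rho> \<gamma> = \<rho> \<delta>" if "similar_elts \<gamma> \<delta>" for \<gamma> \<delta>
  proof -
    have "similar_elts \<gamma> x \<longleftrightarrow> similar_elts \<delta> x" for x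
      using that similar_elts_trans similar_elts_sym by blast
    then show ?thesis by (simp add: \<rho>_def)
  qed
  have eq: "x = y" if xy: "x \<in> \<rho> ` \<Delta>" "y \<in> \<rho> ` \<Delta>" "similar_elts x y" for x y
  proof -
    obtain \<gamma> \<delta> where *: "\<gamma> \<in> \<Delta>" "\<delta> \<in> \<Delta>" "x = \<rho> \<gamma>" "y = \<rho> \<delta>" using xy(1,2) by blast
    then have "similar_elts \<gamma> \<delta>" using \<rho> xy(3) similar_elts_trans similar_elts_sym by metis
    then show ?thesis using \<rho>_eq * by simp
  qed
  have "pairwise (\<lambda>p q. \<not> similar_elts p q) (\<rho> ` \<Delta>)" using eq by (auto simp: pairwise_def)
  moreover have \<rho>\<Delta>: "\<rho> ` \<Delta> \<subseteq> \<Delta>" using \<rho>(1) by blast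
  ultimately have fin: "finite (\<rho> ` \<Delta>)"
    using assms(2) unfolding infinitely_many_classes_def by blast
  then obtain p where p: "bij_betw p {0..<card (\<rho> ` \<Delta>)} (\<rho> ` \<Delta>)"
    using ex_bij_betw_nat_finite by blast
  let ?n = "card (\<rho> ` \<Delta>)"
  have p\<rho>: "p i \<in> \<rho> ` \<Delta>" if "i < ?n" for i
    by (rule bij_betw_apply[OF p]) (simp add: that)
  have p\<Delta>: "p i \<in> \<Delta>" if "i < ?n" for i using subsetD[OF \<rho>\<Delta> p\<rho>[OF that]] .
  have "nonsimilar_atoms ?n p"
    unfolding nonsimilar_atoms_def
  proof (intro conjI allI impI)
    show "p i \<in> atoms" if "i < ?n" for i using p\<Delta>[OF that] assms(1) by blast
    show "\<not> similar_elts (p i) (p j)" if ij: "i < ?n" "j < ?n" "i \<noteq> j" for i j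
    proof
      assume "similar_elts (p i) (p j)"
      then have "p i = p j" by (rule eq[OF p\<rho>[OF ij(1)] p\<rho>[OF ij(2)]])
      then show False using inj_onD[OF bij_betw_imp_inj_on[OF p]] ij by fastforce
    qed
  qed
  moreover have "\<Delta> \<inter> sim_class (p i) \<noteq> {}" if "i < ?n" for i
  proof -
    have "p i \<noteq> 0" using p\<Delta>[OF that] assms(1) atoms_nonzero by auto
    then have "p i \<in> sim_class (p i)" by (simp add: sim_class_iff similar_elts_refl)
    then show ?thesis using p\<Delta>[OF that] by auto
  qed
  moreover have "\<exists>i<?n. \<gamma> \<in> sim_class (p i)" if "\<gamma> \<in> \<Delta>" for \<gamma>
  proof -
    have "\<rho> \<gamma> \<in> p ` {0..<?n}" unfolding bij_betw_imp_surj_on[OF p] using that by simp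
    then obtain i where "i < ?n" "\<rho> \<gamma> = p i" by auto
    then show ?thesis using similar_elts_sym[OF \<rho>(2)[OF that]] by (auto simp: sim_class_iff)
  qed
  ultimately show ?thesis unfolding class_reps_def by blast
qed


section \<open>The set \<open>V(f)\<close>\<close>

lemma finite_length_cases:
  assumes "f \<in> finite_length"
  obtains "f \<in> ring_units" | ps where "set ps \<subseteq> atoms" "f = prod_list ps"
  using assms unfolding finite_length_def atomic_length_def product_of_atoms_def
  by (auto split: if_splits)

lemma finite_length_nonzero:
  fixes f :: "'a::two_fir"
  assumes "f \<in> finite_length"
  shows "f \<noteq> 0"
  using assms
proof (cases rule: finite_length_cases)
  case 1
  then show ?thesis by (auto simp: ring_units_def)
next
  case (2 ps)
  have "set ps \<subseteq> atoms \<Longrightarrow> prod_list ps \<noteq> 0" using atoms_nonzero by (induction ps) auto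
  then show ?thesis using 2 by simp
qed

lemma V_set_atoms: "V_set f \<subseteq> atoms"
  by (auto simp: V_set_def)

lemma V_set_F_algebraic:
  assumes "f \<noteq> 0"
  shows "F_algebraic (V_set f)"
  unfolding F_algebraic_iff[OF V_set_atoms] using assms by (auto simp: V_set_def)

text \<open>If \<open>b\<close> is not in \<open>R\<delta>\<close>, then the annihilator of
  \<open>b + R\<delta>\<close> is \<open>Rq\<close> for an atom \<open>q\<close> similar to
  \<open>\<delta>\<close>, and \<open>a * b\<close> being in \<open>R\<delta>\<close> says that
  \<open>a\<close> is in \<open>Rq\<close>.\<close>

lemma V_set_mult_atom:
  fixes a b :: "'a::two_fir"
  assumes "a \<noteq> 0" "b \<in> atoms" "\<delta> \<in> V_set (a * b)"
  shows "similar_elts b \<delta> \<or> (\<exists>q\<in>V_set a. similar_elts q \<delta>)"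
proof (cases "b \<in> lideal \<delta>")
  case True
  have \<delta>: "\<delta> \<in> atoms" using assms(3) by (simp add: V_set_def)
  have "lideal \<delta> = lideal b" by (rule atom_factor[OF assms(2) True atoms_nonunit[OF \<delta>]])
  then show ?thesis using similar_elts_cong_lideal[of b \<delta>] atoms_nonzero assms(2) \<delta> by metis
next
  case False
  have \<delta>: "\<delta> \<in> atoms" and ab: "a * b \<in> lideal \<delta>" using assms(3) by (auto simp: V_set_def)
  obtain q h where q: "q \<in> atoms" and ann: "\<And>x. x * b \<in> lideal \<delta> \<longleftrightarrow> x \<in> lideal q"
    and h: "h * b - 1 \<in> lideal \<delta>"
    using annihilator_atom[OF \<delta> False assms(1) ab] by metis
  have "q \<in> V_set a" using q ann ab by (simp add: V_set_def)
  moreover have "similar_elts q \<delta>"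
    unfolding similar_elts_iff using ann h atoms_nonzero q \<delta> by metis
  ultimately show ?thesis by blast
qed

lemma V_set_unit:
  fixes f :: "'a::two_fir"
  assumes "f \<in> ring_units"
  shows "V_set f = {}"
proof -
  have "q \<in> ring_units" if "f \<in> lideal q" for q
  proof -
    have "1 \<in> lideal f" using assms by (simp add: ring_units_iff)
    then show ?thesis using that lideal_subset_iff ring_units_iff by blast
  qed
  then show ?thesis using atoms_nonunit by (auto simp: V_set_def)
qed

lemma V_set_finite_classes:
  fixes f :: "'a::two_fir"
  assumes "f \<in> finite_length"
  shows "\<exists>N. finite N \<and> (\<forall>\<delta>\<in>V_set f. \<exists>\<nu>\<in>N. similar_elts \<nu> \<delta>)"
  using assms
proof (cases rule: finite_length_cases)
  case 1
  then show ?thesis using V_set_unit by blast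
next
  case (2 ps)
  have "set ps \<subseteq> atoms \<Longrightarrow> prod_list ps \<noteq> 0 \<and>
    (\<exists>N. finite N \<and> (\<forall>\<delta>\<in>V_set (prod_list ps). \<exists>\<nu>\<in>N. similar_elts \<nu> \<delta>))"
  \<comment> \<open>Elements of \<open>V_set\<close> are right divisors, so the last factor is the
    one to split off.\<close>
  proof (induction ps rule: rev_induct)
    case Nil
    have "V_set (1::'a) = {}" by (rule V_set_unit) (auto simp: ring_units_iff)
    then show ?case by auto
  next
    case (snoc b ps)
    let ?a = "prod_list ps"
    have b: "b \<in> atoms" "b \<noteq> 0" using snoc.prems atoms_nonzero by auto
    obtain N where a: "?a \<noteq> 0" and N: "finite N" "\<forall>\<delta>\<in>V_set ?a. \<exists>\<nu>\<in>N. similar_elts \<nu> \<delta>"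
      using snoc by auto
    have "\<exists>\<nu>\<in>insert b N. similar_elts \<nu> \<delta>" if "\<delta> \<in> V_set (?a * b)" for \<delta>
      using V_set_mult_atom[OF a b(1) that] N(2) similar_elts_trans by blast
    then show ?case using a b(2) N(1) by (intro conjI exI[of _ "insert b N"]) auto
  qed
  then show ?thesis using 2 by blast
qed

lemma V_set_not_infinitely_many_classes:
  fixes f :: "'a::two_fir"
  assumes "f \<in> finite_length"
  shows "\<not> infinitely_many_classes (V_set f)"
proof
  assume "infinitely_many_classes (V_set f)"
  then obtain S where S: "S \<subseteq> V_set f" "infinite S" "pairwise (\<lambda>p q. \<not> similar_elts p q) S"
    unfolding infinitely_many_classes_def by blast
  obtain N where N: "finite N" "\<forall>\<delta>\<in>V_set f. \<exists>\<nu>\<in>N. similar_elts \<nu> \<delta>"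
    using V_set_finite_classes[OF assms] by blast
  then obtain \<nu> where \<nu>: "\<forall>\<delta>\<in>V_set f. \<nu> \<delta> \<in> N \<and> similar_elts (\<nu> \<delta>) \<delta>" by metis
  have "inj_on \<nu> S"
  proof (rule inj_onI, rule ccontr)
    fix x y assume *: "x \<in> S" "y \<in> S" "\<nu> x = \<nu> y" "x \<noteq> y"
    then have "similar_elts (\<nu> x) x" "similar_elts (\<nu> y) y" using \<nu> S(1) by blast+
    then have "similar_elts (\<nu> x) x" "similar_elts (\<nu> x) y" using *(3) by simp_all
    then have "similar_elts x y" using similar_elts_sym similar_elts_trans by blast
    then show False using S(3) * by (auto simp: pairwise_def)
  qed
  moreover have "\<nu> ` S \<subseteq> N" using \<nu> S(1) by blast
  ultimately show False using S(2) N(1) finite_subset finite_imageD by blast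
qed

section \<open>The kernel of left multiplication by \<open>f\<close>\<close>

lemma lmult_ker_eq: "lmult_ker f p = qcoset p ` {z. f * z \<in> lideal p}"
proof -
  have "lmult f p (qcoset p z) = lideal p \<longleftrightarrow> f * z \<in> lideal p" for z
  proof -
    have "lmult f p (qcoset p z) = qcoset p (f * z)" by (simp add: lmult_def qscale_qcoset)
    moreover have "qcoset p (f * z) = lideal p \<longleftrightarrow> qcoset p (f * z) = qcoset p 0"
      by (simp flip: lideal_eq_qcoset)
    ultimately show ?thesis by (simp add: qcoset_eq_iff)
  qed
  then show ?thesis by (auto simp: lmult_ker_def elim!: qmodE)
qed

text \<open>A nonzero coset \<open>z + Rp\<close> killed by \<open>f\<close> has annihilator
  \<open>Rq\<close> with \<open>q\<close> an atom similar to \<open>p\<close>, and \<open>f\<close>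
  lies in \<open>Rq\<close>. So every kernel vector comes from an atom of
  \<open>V_set f\<close>.\<close>

lemma lmult_ker_eq_span:
  fixes p f :: "'a::two_fir"
  assumes p: "p \<in> atoms" and f: "f \<noteq> 0"
    and \<psi>: "\<And>\<gamma>. \<gamma> \<in> V_set f \<inter> sim_class p \<Longrightarrow> \<psi> \<gamma> \<in> qiso \<gamma> p"
  shows "lmult_ker f p = C_span p ((\<lambda>\<gamma>. \<psi> \<gamma> (qcoset \<gamma> 1)) ` (V_set f \<inter> sim_class p))"
    (is "_ = C_span p ?Y")
proof -
  have rep: "\<exists>g. \<psi> \<gamma> (qcoset \<gamma> 1) = qcoset p g \<and> (\<forall>x. x * g \<in> lideal p \<longleftrightarrow> x \<in> lideal \<gamma>)"
    if \<gamma>: "\<gamma> \<in> V_set f \<inter> sim_class p" for \<gamma>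
  proof -
    have "\<psi> \<gamma> (qcoset \<gamma> 1) \<in> qmod p" using \<psi>[OF \<gamma>] by (auto simp: qiso_def qhom_def)
    then obtain g where "\<psi> \<gamma> (qcoset \<gamma> 1) = qcoset p g" by (rule qmodE)
    then show ?thesis using qiso_rep(1)[OF \<psi>[OF \<gamma>]] by blast
  qed
  have sub: "?Y \<subseteq> qmod p" using rep by fastforce
  show ?thesis
    unfolding lmult_ker_eq
  proof (intro equalityI subsetI)
    fix A assume "A \<in> qcoset p ` {z. f * z \<in> lideal p}"
    then obtain z where A: "A = qcoset p z" and z: "f * z \<in> lideal p" by blast
    show "A \<in> C_span p ?Y"
    proof (cases "z \<in> lideal p")
      case True
      then have "qcoset p z = qcoset p 0" by (simp add: qcoset_eq_iff)
      then show ?thesis using C_span_zero[OF sub] A by simp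
    next
      case False
      obtain q h where q: "q \<in> atoms" and ann: "\<And>x. x * z \<in> lideal p \<longleftrightarrow> x \<in> lideal q"
        and h: "h * z - 1 \<in> lideal p"
        using annihilator_atom[OF p False f z] by metis
      have "similar_elts q p" unfolding similar_elts_iff using ann h atoms_nonzero p q by metis
      then have qV: "q \<in> V_set f \<inter> sim_class p"
        using similar_elts_sym q ann z by (auto simp: V_set_def sim_class_iff)
      obtain g where g: "\<psi> q (qcoset q 1) = qcoset p g" "\<And>x. x * g \<in> lideal p \<longleftrightarrow> x \<in> lideal q"
        using rep[OF qV] by auto
      \<comment> \<open>\<open>z\<close> and the vector \<open>g\<close> chosen for \<open>q\<close>
        have the same annihilator; \<open>density\<close> for the single vector \<open>g\<close>
        makes \<open>z\<close> a scalar multiple of it.\<close>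
      have "qcoset p z \<in> C_span p (qcoset p ` {g})"
      proof (rule density[OF p f])
        show "f * y \<in> lideal p" if "y \<in> {g}" for y using that g(2) ann z by simp
        show "r * z \<in> lideal p" if "\<forall>y\<in>{g}. r * y \<in> lideal p" for r using that g(2) ann by simp
      qed simp
      moreover have "qcoset p g \<in> ?Y"
        using imageI[OF qV, of "\<lambda>\<gamma>. \<psi> \<gamma> (qcoset \<gamma> 1)"] g(1) by simp
      then have "qcoset p ` {g} \<subseteq> ?Y" by simp
      then have "C_span p (qcoset p ` {g}) \<subseteq> C_span p ?Y" by (rule C_span_mono)
      ultimately show ?thesis using A by blast
    qed
  next
    have "?Y \<subseteq> qcoset p ` {z. f * z \<in> lideal p}"
    proof
      fix A assume "A \<in> ?Y"
      then obtain \<gamma> where \<gamma>: "\<gamma> \<in> V_set f \<inter> sim_class p" "A = \<psi> \<gamma> (qcoset \<gamma> 1)" by blast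
      then show "A \<in> qcoset p ` {z. f * z \<in> lideal p}"
        using rep[OF \<gamma>(1)] by (auto simp: V_set_def)
    qed
    then have "C_span p ?Y \<subseteq> qcoset p ` {z. f * z \<in> lideal p}"
      using C_subspace_annihilated by (rule C_span_minimal)
    then show "A \<in> C_span p ?Y \<Longrightarrow> A \<in> qcoset p ` {z. f * z \<in> lideal p}" for A by blast
  qed
qed

text \<open>The kernel does not mention isomorphisms, so any choice of them for the atoms of
  \<open>V_set f\<close> similar to \<open>p\<close> may be used.\<close>

lemma C_dim_lmult_ker:
  fixes p f :: "'a::two_fir"
  assumes p: "p \<in> atoms" and f: "f \<noteq> 0"
  shows "C_dim p (lmult_ker f p) = F_rank (V_set f \<inter> sim_class p)"
proof -
  let ?V = "V_set f \<inter> sim_class p"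
  have "\<forall>\<gamma>\<in>?V. \<exists>\<psi>. \<psi> \<in> qiso \<gamma> p"
  proof
    fix \<gamma> assume "\<gamma> \<in> ?V"
    then have "similar_elts \<gamma> p" by (simp add: sim_class_iff similar_elts_sym)
    then show "\<exists>\<psi>. \<psi> \<in> qiso \<gamma> p" unfolding similar_elts_def by blast
  qed
  then obtain \<psi> where \<psi>: "\<And>\<gamma>. \<gamma> \<in> ?V \<Longrightarrow> \<psi> \<gamma> \<in> qiso \<gamma> p" by metis
  have "F_algebraic ?V" "?V \<subseteq> atoms"
    using F_algebraic_subset[OF V_set_F_algebraic[OF f] V_set_atoms] V_set_atoms by auto
  from C_dim_eq_F_rank[OF p this \<psi>] show ?thesis by (simp only: lmult_ker_eq_span[OF p f \<psi>])
qed

theorem corollary4p14: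
  fixes \<Delta> :: "'a::two_fir set" and \<phi> :: "'a \<Rightarrow> 'a \<Rightarrow> 'a set \<Rightarrow> 'a set"
  assumes "F_algebraic \<Delta>" and "\<Delta> \<subseteq> atoms" and "iso_choice \<Delta> \<phi>"
  shows "(F_rank \<Delta> = \<infinity> \<longleftrightarrow> infinitely_many_classes \<Delta> \<or> infinite_dim_class \<Delta> \<phi>)
    \<and> (\<not> infinitely_many_classes \<Delta> \<and> \<not> infinite_dim_class \<Delta> \<phi> \<longrightarrow>
         F_rank \<Delta> \<noteq> \<infinity>
         \<and> (\<exists>n p. class_reps \<Delta> n p)
         \<and> (\<forall>n p. class_reps \<Delta> n p \<longrightarrow>
              \<Delta> = (\<Union>i<n. \<Delta> \<inter> sim_class (p i))
              \<and> F_rank \<Delta> = (\<Sum>i<n. C_dim (p i) (gen_subspace \<phi> (p i) (\<Delta> \<inter> sim_class (p i))))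
              \<and> F_closure \<Delta> = (\<Union>i<n. F_closure (\<Delta> \<inter> sim_class (p i)))))
    \<and> (\<forall>f\<in>(finite_length :: 'a set).
         (\<exists>r p. class_reps (V_set f) r p)
         \<and> (\<forall>r p. nonsimilar_atoms r p \<and> V_set f = (\<Union>i<r. V_set f \<inter> sim_class (p i)) \<longrightarrow>
              F_rank (V_set f) = (\<Sum>i<r. C_dim (p i) (lmult_ker f (p i)))))"
proof -
  note \<Delta> = assms(1,2)
  have sub: "F_algebraic S" "S \<subseteq> atoms" if "S \<subseteq> \<Delta>" for S
    using F_algebraic_subset[OF \<Delta> that] \<Delta> that by auto
  have dim: "C_dim p (gen_subspace \<phi> p S) = F_rank S" if p: "p \<in> atoms" and S: "S \<subseteq> \<Delta> \<inter> sim_class p" for p S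
    unfolding gen_subspace_def
  proof (rule C_dim_eq_F_rank[OF p])
    show "F_algebraic S" "S \<subseteq> atoms" using sub S by blast+
    show "\<phi> p \<gamma> \<in> qiso \<gamma> p" if "\<gamma> \<in> S" for \<gamma>
      using assms(3) p S that unfolding iso_choice_def by blast
  qed
  have cover: "\<Delta> = (\<Union>i<n. \<Delta> \<inter> sim_class (p i))" if "class_reps \<Delta> n p" for n p
    using that unfolding class_reps_def by blast
  have rank: "F_rank \<Delta> = (\<Sum>i<n. C_dim (p i) (gen_subspace \<phi> (p i) (\<Delta> \<inter> sim_class (p i))))"
    if reps: "class_reps \<Delta> n p" for n p
  proof -
    have p: "nonsimilar_atoms n p" using reps by (simp add: class_reps_def)
    have "F_rank \<Delta> = (\<Sum>i<n. F_rank (\<Delta> \<inter> sim_class (p i)))"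
      by (rule F_rank_sum[OF \<Delta> p cover[OF reps]])
    also have "\<dots> = (\<Sum>i<n. C_dim (p i) (gen_subspace \<phi> (p i) (\<Delta> \<inter> sim_class (p i))))"
      using p by (intro sum.cong refl) (simp add: dim nonsimilar_atoms_def)
    finally show ?thesis .
  qed
  have reps: "\<exists>n p. class_reps \<Delta> n p" if "\<not> infinitely_many_classes \<Delta>"
    using class_reps_exists[OF \<Delta>(2) that] .
  have inf_a: "F_rank \<Delta> = \<infinity>" if inf: "infinitely_many_classes \<Delta>"
  proof -
    obtain S where S: "S \<subseteq> \<Delta>" "infinite S" "pairwise (\<lambda>p q. \<not> similar_elts p q) S"
      using inf unfolding infinitely_many_classes_def by blast
    \<comment> \<open>A dependence of \<open>\<delta>\<close> would use only atoms of
      \<open>S - {\<delta>}\<close> similar to \<open>\<delta>\<close>; there are none, and no atom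
      depends on the empty set.\<close>
    have "\<not> F_dependent \<delta> (S - {\<delta>})" if \<delta>: "\<delta> \<in> S" for \<delta>
    proof
      assume "F_dependent \<delta> (S - {\<delta>})"
      then have "F_dependent \<delta> ((S - {\<delta>}) \<inter> sim_class \<delta>)"
        using S(1) \<delta> by (intro F_dependent_Int_sim_class[OF \<Delta>]) auto
      moreover have "(S - {\<delta>}) \<inter> sim_class \<delta> = {}"
      proof (rule equals0I)
        fix \<gamma> assume "\<gamma> \<in> (S - {\<delta>}) \<inter> sim_class \<delta>"
        then have "\<gamma> \<in> S" "\<delta> \<noteq> \<gamma>" "similar_elts \<delta> \<gamma>" by (auto simp: sim_class_iff)
        then show False using S(3) \<delta> unfolding pairwise_def by blast
      qed
      ultimately show False using not_F_dependent_empty[of \<delta>] \<delta> sub(2)[OF S(1)] by auto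
    qed
    then have "F_independent S" using sub(1)[OF S(1)] by (simp add: F_independent_def)
    then have "ecard S \<le> F_rank \<Delta>" by (rule ecard_F_independent_le[OF \<Delta> S(1)])
    then show ?thesis using S(2) by (simp add: ecard_def)
  qed
  have inf_b: "F_rank \<Delta> = \<infinity>" if inf: "infinite_dim_class \<Delta> \<phi>"
  proof -
    obtain p S where S: "p \<in> atoms" "S \<subseteq> \<Delta> \<inter> sim_class p" "C_dim p (gen_subspace \<phi> p S) = \<infinity>"
      using inf unfolding infinite_dim_class_def by blast
    then have "\<infinity> \<le> F_rank \<Delta>" using F_rank_mono[OF \<Delta>, of S] dim by auto
    then show ?thesis by simp
  qed
  have fin: "F_rank \<Delta> \<noteq> \<infinity>" if a: "\<not> infinitely_many_classes \<Delta>" and b: "\<not> infinite_dim_class \<Delta> \<phi>"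
  proof -
    obtain n p where np: "class_reps \<Delta> n p" using reps[OF a] by blast
    have "C_dim (p i) (gen_subspace \<phi> (p i) (\<Delta> \<inter> sim_class (p i))) \<noteq> \<infinity>" if i: "i < n" for i
    \<comment> \<open>\<open>infinite_dim_class\<close> speaks only of infinite sets of atoms, so a
      class met in finitely many atoms needs the separate bound by a finite basis.\<close>
    proof (cases "finite (\<Delta> \<inter> sim_class (p i))")
      case True
      have "p i \<in> atoms" using np i by (simp add: class_reps_def nonsimilar_atoms_def)
      then show ?thesis using dim[OF _ order_refl] F_rank_finite[OF sub[OF Int_lower1] True] by simp
    next
      case False
      have "p i \<in> atoms" using np i by (simp add: class_reps_def nonsimilar_atoms_def)
      show ?thesis
      proof
        assume "C_dim (p i) (gen_subspace \<phi> (p i) (\<Delta> \<inter> sim_class (p i))) = \<infinity>"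
        then have "infinite_dim_class \<Delta> \<phi>"
          unfolding infinite_dim_class_def using False
          by (intro bexI[OF _ \<open>p i \<in> atoms\<close>] exI[of _ "\<Delta> \<inter> sim_class (p i)"]) simp
        then show False using b by simp
      qed
    qed
    then show ?thesis unfolding rank[OF np] by (rule sum_enat_ne_infinity)
  qed
  have V: "F_rank (V_set f) = (\<Sum>i<r. C_dim (p i) (lmult_ker f (p i)))"
    if f: "f \<in> finite_length" and p: "nonsimilar_atoms r p"
      and c: "V_set f = (\<Union>i<r. V_set f \<inter> sim_class (p i))" for f :: 'a and r p
  proof -
    have f0: "f \<noteq> 0" using f by (rule finite_length_nonzero)
    have "F_rank (V_set f) = (\<Sum>i<r. F_rank (V_set f \<inter> sim_class (p i)))"
      by (rule F_rank_sum[OF V_set_F_algebraic[OF f0] V_set_atoms p c])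
    then show ?thesis using p by (simp add: C_dim_lmult_ker f0 nonsimilar_atoms_def)
  qed
  have Vreps: "\<exists>r p. class_reps (V_set f) r p" if "f \<in> finite_length" for f :: 'a
    by (rule class_reps_exists[OF V_set_atoms V_set_not_infinitely_many_classes[OF that]])
  show ?thesis
  proof (intro conjI ballI allI impI)
    show "F_rank \<Delta> = \<infinity> \<longleftrightarrow> infinitely_many_classes \<Delta> \<or> infinite_dim_class \<Delta> \<phi>"
      using inf_a inf_b fin by blast
    show "F_rank (V_set f) = (\<Sum>i<r. C_dim (p i) (lmult_ker f (p i)))"
      if "f \<in> finite_length"
        "nonsimilar_atoms r p \<and> V_set f = (\<Union>i<r. V_set f \<inter> sim_class (p i))" for f :: 'a and r p
      using V that by blast
    show "\<Delta> = (\<Union>i<n. \<Delta> \<inter> sim_class (p i))" if "class_reps \<Delta> n p" for n p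
      using that by (rule cover)
    show "F_rank \<Delta> = (\<Sum>i<n. C_dim (p i) (gen_subspace \<phi> (p i) (\<Delta> \<inter> sim_class (p i))))"
      if "class_reps \<Delta> n p" for n p
      using that by (rule rank)
    show "F_closure \<Delta> = (\<Union>i<n. F_closure (\<Delta> \<inter> sim_class (p i)))" if "class_reps \<Delta> n p" for n p
      using that by (rule F_closure_Union[OF \<Delta>])
  qed (use fin reps Vreps in auto)
qed

end
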